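(* The Cantor representation of $\mathrm{Pen}$ is deterministic, and a relational representation of $\mathrm{Pen}$ is algebraically irreducible if, and only if, it is equivalent to an irreducible component of the Cantor representation.
   Context: Quantales: "quantale" means unital involutive quantale: a sup-lattice $Q$ (poset with all joins) with an associative multiplication $\&$ preserving arbitrary joins in each variable, a unit $e$, and a join-preserving involution ${}^*$ with $a^{**}=a$, $(a\& b)^*=b^*\& a^*$. Bottom is $0$, top is $1$. A homomorphism $h$ preserves all joins, multiplication, involution and satisfies $h(e)\ge e$ (strictly unital if $h(e)=e$). Relational representations: $\mathcal Q(X)$ is the quantale of binary relations on a set $X$ ordered by inclusion, $R\& S=\{(x,z):\exists y,\ xRy,\ ySz\}$, unit $\Delta_X$, involution the converse. A relational representation of $Q$ on $X$ is a homomorphism $r:Q\to\mathcal Q(X)$; write $x\langle a\rangle y$ (or $x\,a\,y$) for $(x,y)\in r(a)$, and $Za=\{y: \exists z\in Z,\ z\langle a\rangle y\}$ for $Z\subseteq X$. The relation $r(1)$ is an equivalence relation; its classes are the connected components, and the restrictions $a\mapsto r(a)\cap(C\times C)$ of $r$ to the connected components $C$ are the irreducible components of $r$. The representation is deterministic if whenever $x\langle 1\rangle y$ there is $a\in Q$ with $\{x\}a=\{y\}$. It is algebraically irreducible if $X\ne\emptyset$ and $\{\{x\}a: a\in Q\}=\mathcal P(X)$ for each $x\in X$. Representations on $X$ and $X'$ are equivalent if there is a sup-lattice isomorphism $f:\mathcal P(X)\to\mathcal P(X')$ with $f(Za)=f(Z)a$ and $Y\cap Z=\emptyset\iff f(Y)\cap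 f(Z)=\emptyset$. The quantale $\mathrm{Pen}$: it is the quantale presented by generators $\langle A^{(n)}|$ ($n\in\mathbb N=\{0,1,2,\dots\}$, $A\in\{S,L\}$), where $|A^{(n)}\rangle:=\langle A^{(n)}|^*$, juxtaposition denotes $\&$, and the relations are, for all $n$ and $A,B\in\{S,L\}$: (C1) $\langle L^{(n)}|\,|S^{(n)}\rangle\le 0$; (C2) $\langle S^{(n)}|\le\langle L^{(n+1)}|$; (D1) $e\le\langle L^{(n)}|\vee\langle S^{(n)}|$; (D2) $|A^{(n+1)}\rangle\langle A^{(n+1)}|\le\langle S^{(n)}|\vee\langle L^{(n)}|$; (E1) $\langle B^{(n)}|\langle A^{(n+1)}|\le\langle A^{(n+1)}|$; (E2) $\langle A^{(n+1)}|\langle B^{(n)}|\le\langle A^{(n+1)}|$; (E3) $|B^{(n)}\rangle\langle A^{(n+1)}|\le\langle A^{(n+1)}|$; (E4) $\langle A^{(n+1)}|\,|B^{(n)}\rangle\le\langle A^{(n+1)}|$; (C') $e\le\langle A_n^{(n)}|\cdots\langle A_0^{(0)}|\,|A_0^{(0)}\rangle\cdots|A_n^{(n)}\rangle$ for every string $A_0,\dots,A_n\in\{S,L\}$ that is admissible ($A_i=S$ implies $A_{i+1}=L$ for $0\le i<n$) and has $A_n=L$. That is, for any quantale $Q$ and any family of elements of $Q$ satisfying the corresponding inequalities there is a unique strictly unital homomorphism $\mathrm{Pen}\to Q$ sending the generators to these elements. Penrose sequences and the Cantor representation: $K$ is the set of $s\in\{0,1\}^{\mathbb N}$ such that $s_n=1$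 implies $s_{n+1}=0$. The Cantor representation is the relational representation of $\mathrm{Pen}$ on $K$ determined by: $s\langle L^{(n)}|t$ iff $t_n=0$ and $s_m=t_m$ for all $m>n$; $s\langle S^{(n)}|t$ iff $t_n=1$ and $s_m=t_m$ for all $m>n$. *)

theory Defs
  imports "HOL-Algebra.Complete_Lattice"
begin

section \<open>Unital involutive quantales\<close>

record 'a quantale = "'a gorder" +
  qmult :: "'a \<Rightarrow> 'a \<Rightarrow> 'a" (infixl \<open>\<otimes>\<index>\<close> 70)
  qunit :: 'a
  qstar :: "'a \<Rightarrow> 'a"

locale quantale = complete_lattice Q for Q :: "'a quantale" (structure) +
  assumes mult_closed: "\<lbrakk>a \<in> carrier Q; b \<in> carrier Q\<rbrakk> \<Longrightarrow> a \<otimes> b \<in> carrier Q"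
    and unit_closed: "qunit Q \<in> carrier Q"
    and star_closed: "a \<in> carrier Q \<Longrightarrow> qstar Q a \<in> carrier Q"
    and mult_assoc: "\<lbrakk>a \<in> carrier Q; b \<in> carrier Q; c \<in> carrier Q\<rbrakk> \<Longrightarrow> (a \<otimes> b) \<otimes> c = a \<otimes> (b \<otimes> c)"
    and unit_left: "a \<in> carrier Q \<Longrightarrow> qunit Q \<otimes> a = a"
    and unit_right: "a \<in> carrier Q \<Longrightarrow> a \<otimes> qunit Q = a"
    and sup_mult: "\<lbrakk>A \<subseteq> carrier Q; b \<in> carrier Q\<rbrakk> \<Longrightarrow> (\<Squnion>A) \<otimes> b = \<Squnion>((\<lambda>a. a \<otimes> b) ` A)"
    and mult_sup: "\<lbrakk>A \<subseteq> carrier Q; b \<in> carrier Q\<rbrakk> \<Longrightarrow> b \<otimes> (\<Squnion>A) = \<Squnion>((\<lambda>a. b \<otimes> a) ` A)"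
    and star_sup: "A \<subseteq> carrier Q \<Longrightarrow> qstar Q (\<Squnion>A) = \<Squnion>(qstar Q ` A)"
    and star_star: "a \<in> carrier Q \<Longrightarrow> qstar Q (qstar Q a) = a"
    and star_mult: "\<lbrakk>a \<in> carrier Q; b \<in> carrier Q\<rbrakk> \<Longrightarrow> qstar Q (a \<otimes> b) = qstar Q b \<otimes> qstar Q a"

definition quantale_hom :: "'a quantale \<Rightarrow> 'b quantale \<Rightarrow> ('a \<Rightarrow> 'b) \<Rightarrow> bool" where
  "quantale_hom P Q h \<longleftrightarrow>
     h \<in> carrier P \<rightarrow> carrier Q \<and>
     (\<forall>A. A \<subseteq> carrier P \<longrightarrow> h (\<Squnion>\<^bsub>P\<^esub>A) = \<Squnion>\<^bsub>Q\<^esub>(h ` A)) \<and>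
     (\<forall>a\<in>carrier P. \<forall>b\<in>carrier P. h (a \<otimes>\<^bsub>P\<^esub> b) = h a \<otimes>\<^bsub>Q\<^esub> h b) \<and>
     (\<forall>a\<in>carrier P. h (qstar P a) = qstar Q (h a)) \<and>
     qunit Q \<sqsubseteq>\<^bsub>Q\<^esub> h (qunit P)"

definition strictly_unital_hom :: "'a quantale \<Rightarrow> 'b quantale \<Rightarrow> ('a \<Rightarrow> 'b) \<Rightarrow> bool" where
  "strictly_unital_hom P Q h \<longleftrightarrow> quantale_hom P Q h \<and> h (qunit P) = qunit Q"


section \<open>Relational representations\<close>

definition rel_quantale :: "'x set \<Rightarrow> ('x \<times> 'x) set quantale" where
  "rel_quantale X = \<lparr>carrier = Pow (X \<times> X), eq = (=), le = (\<subseteq>),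
     qmult = (O), qunit = Id_on X, qstar = converse\<rparr>"

definition relational_rep :: "'a quantale \<Rightarrow> 'x set \<Rightarrow> ('a \<Rightarrow> ('x \<times> 'x) set) \<Rightarrow> bool" where
  "relational_rep Q X r \<longleftrightarrow> quantale_hom Q (rel_quantale X) r"

text \<open>In the following definitions the image \<open>r a `` Z\<close> is the set written \<open>Z a\<close> in the
  literature, and \<open>\<top>\<^bsub>Q\<^esub>\<close> is the element written \<open>1\<close>.\<close>

definition connected_components :: "'a quantale \<Rightarrow> 'x set \<Rightarrow> ('a \<Rightarrow> ('x \<times> 'x) set) \<Rightarrow> 'x set set" where
  "connected_components Q X r = X // r \<top>\<^bsub>Q\<^esub>"

definition restrict_rep :: "('a \<Rightarrow> ('x \<times> 'x) set) \<Rightarrow> 'x set \<Rightarrow> 'a \<Rightarrow> ('x \<times> 'x) set" where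
  "restrict_rep r C a = r a \<inter> (C \<times> C)"

definition deterministic_rep :: "'a quantale \<Rightarrow> 'x set \<Rightarrow> ('a \<Rightarrow> ('x \<times> 'x) set) \<Rightarrow> bool" where
  "deterministic_rep Q X r \<longleftrightarrow>
     (\<forall>x\<in>X. \<forall>y\<in>X. (x, y) \<in> r \<top>\<^bsub>Q\<^esub> \<longrightarrow> (\<exists>a\<in>carrier Q. r a `` {x} = {y}))"

definition algebraically_irreducible :: "'a quantale \<Rightarrow> 'x set \<Rightarrow> ('a \<Rightarrow> ('x \<times> 'x) set) \<Rightarrow> bool" where
  "algebraically_irreducible Q X r \<longleftrightarrow>
     X \<noteq> {} \<and> (\<forall>x\<in>X. {r a `` {x} |a. a \<in> carrier Q} = Pow X)"

definition equivalent_reps ::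
  "'a quantale \<Rightarrow> 'x set \<Rightarrow> ('a \<Rightarrow> ('x \<times> 'x) set) \<Rightarrow> 'y set \<Rightarrow> ('a \<Rightarrow> ('y \<times> 'y) set) \<Rightarrow> bool" where
  "equivalent_reps Q X r X' r' \<longleftrightarrow>
     (\<exists>f. bij_betw f (Pow X) (Pow X') \<and>
          (\<forall>\<Z>. \<Z> \<subseteq> Pow X \<longrightarrow> f (\<Union>\<Z>) = \<Union>(f ` \<Z>)) \<and>
          (\<forall>a\<in>carrier Q. \<forall>Z\<in>Pow X. f (r a `` Z) = r' a `` f Z) \<and>
          (\<forall>Y\<in>Pow X. \<forall>Z\<in>Pow X. Y \<inter> Z = {} \<longleftrightarrow> f Y \<inter> f Z = {}))"


section \<open>Quantales presented by generators and relations\<close>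

text \<open>Words are the elements of the free involutive monoid on \<open>'g\<close>; the letter \<open>(g, True)\<close>
  stands for the adjoint of the generator \<open>(g, False)\<close>. The sets of words form the
  free unital involutive quantale on \<open>'g\<close>, and a relation \<open>a \<le> b\<close> between two elements of it is
  given as the pair \<open>(a, b)\<close>. The elements of the presented quantale are the sets of
  words that are closed under all consequences \<open>u a v \<le> u b v\<close> and \<open>u a\<^sup>* v \<le> u b\<^sup>* v\<close>
  of the relations; it is the quotient of the free quantale by the least congruence that
  forces the relations. The lemmas of the last part of this section establish the universal
  property.\<close>

type_synonym 'g word = "('g \<times> bool) list"

definition word_star :: "'g word \<Rightarrow> 'g word" where
  "word_star w = rev (map (\<lambda>(g, b). (g, \<not> b)) w)"

definition lang_mult :: "'g word set \<Rightarrow> 'g word set \<Rightarrow> 'g word set" (infixl \<open>\<odot>\<close> 75) where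
  "U \<odot> V = {u @ v |u v. u \<in> U \<and> v \<in> V}"

definition saturated :: "('g word set \<times> 'g word set) set \<Rightarrow> 'g word set \<Rightarrow> bool" where
  "saturated R U \<longleftrightarrow> (\<forall>(a, b)\<in>R. \<forall>u v.
     ({u} \<odot> b \<odot> {v} \<subseteq> U \<longrightarrow> {u} \<odot> a \<odot> {v} \<subseteq> U) \<and>
     ({u} \<odot> word_star ` b \<odot> {v} \<subseteq> U \<longrightarrow> {u} \<odot> word_star ` a \<odot> {v} \<subseteq> U))"

definition saturation :: "('g word set \<times> 'g word set) set \<Rightarrow> 'g word set \<Rightarrow> 'g word set" where
  "saturation R U = \<Inter>{V. saturated R V \<and> U \<subseteq> V}"

definition presented_quantale :: "('g word set \<times> 'g word set) set \<Rightarrow> 'g word set quantale" where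
  "presented_quantale R = \<lparr>carrier = {U. saturated R U}, eq = (=), le = (\<subseteq>),
     qmult = (\<lambda>U V. saturation R (U \<odot> V)), qunit = saturation R {[]}, qstar = (`) word_star\<rparr>"

definition presented_gen :: "('g word set \<times> 'g word set) set \<Rightarrow> 'g \<Rightarrow> 'g word set" where
  "presented_gen R g = saturation R {[(g, False)]}"

fun eval_word :: "'q quantale \<Rightarrow> ('g \<Rightarrow> 'q) \<Rightarrow> 'g word \<Rightarrow> 'q" where
  "eval_word Q \<gamma> [] = qunit Q"
| "eval_word Q \<gamma> ((g, b) # w) = (if b then qstar Q (\<gamma> g) else \<gamma> g) \<otimes>\<^bsub>Q\<^esub> eval_word Q \<gamma> w"

definition eval_lang :: "'q quantale \<Rightarrow> ('g \<Rightarrow> 'q) \<Rightarrow> 'g word set \<Rightarrow> 'q" where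
  "eval_lang Q \<gamma> U = \<Squnion>\<^bsub>Q\<^esub>(eval_word Q \<gamma> ` U)"

definition satisfies_relations ::
  "'q quantale \<Rightarrow> ('g \<Rightarrow> 'q) \<Rightarrow> ('g word set \<times> 'g word set) set \<Rightarrow> bool" where
  "satisfies_relations Q \<gamma> R \<longleftrightarrow> (\<forall>(a, b)\<in>R. eval_lang Q \<gamma> a \<sqsubseteq>\<^bsub>Q\<^esub> eval_lang Q \<gamma> b)"

subsection \<open>Joins\<close>

lemma complete_lattice_setI:
  fixes L :: "('b set, 'c) gorder_scheme"
  assumes eq: "eq L = (=)" and le: "le L = (\<subseteq>)"
    and ub: "\<And>A. A \<subseteq> carrier L \<Longrightarrow> least L (s A) (Upper L A)"
  shows "complete_lattice L"
proof -
  have po: "partial_order L"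
    by unfold_locales (auto simp: eq le)
  interpret partial_order L by (rule po)
  have inf: "\<exists>i. greatest L i (Lower L A)" if "A \<subseteq> carrier L" for A
  proof -
    have sub: "Lower L A \<subseteq> carrier L" by (auto simp: Lower_def)
    note l = ub[OF sub]
    have "greatest L (s (Lower L A)) (Lower L A)"
      using l that unfolding greatest_def least_def Upper_def Lower_def le by blast
    then show ?thesis ..
  qed
  show ?thesis
    by unfold_locales (use ub inf in blast)+
qed

lemma sup_eqI:
  fixes L :: "('b set, 'c) gorder_scheme"
  assumes le: "le L = (\<subseteq>)" and s: "least L s (Upper L A)"
  shows "\<Squnion>\<^bsub>L\<^esub>A = s"
proof -
  have "least L (\<Squnion>\<^bsub>L\<^esub>A) (Upper L A)"
    unfolding Lattice.sup_def using s by (rule someI)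
  then show ?thesis
    using s unfolding least_def le by blast
qed

lemma rel_quantale_simps [simp]:
  "carrier (rel_quantale X) = Pow (X \<times> X)" "eq (rel_quantale X) = (=)"
  "le (rel_quantale X) = (\<subseteq>)" "qmult (rel_quantale X) = (O)"
  "qunit (rel_quantale X) = Id_on X" "qstar (rel_quantale X) = converse"
  by (simp_all add: rel_quantale_def)

lemma rel_quantale_least:
  "A \<subseteq> Pow (X \<times> X) \<Longrightarrow> least (rel_quantale X) (\<Union>A) (Upper (rel_quantale X) A)"
  unfolding least_def Upper_def by (auto, blast)

lemma rel_quantale_sup [simp]:
  "A \<subseteq> Pow (X \<times> X) \<Longrightarrow> \<Squnion>\<^bsub>rel_quantale X\<^esub>A = \<Union>A"
  by (rule sup_eqI) (simp_all add: rel_quantale_least)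

lemma quantale_rel_quantale: "quantale (rel_quantale X)"
proof -
  interpret complete_lattice "rel_quantale X"
    by (rule complete_lattice_setI[where s = Union]) (simp_all add: rel_quantale_least)
  have sup: "\<Squnion>\<^bsub>rel_quantale X\<^esub>(f ` A) = \<Union>(f ` A)"
    if "\<And>a. a \<in> A \<Longrightarrow> f a \<subseteq> X \<times> X" for f :: "('a \<times> 'a) set \<Rightarrow> _" and A
    using that by (intro rel_quantale_sup) auto
  show ?thesis
  proof
    fix A b assume A: "A \<subseteq> carrier (rel_quantale X)" and b: "b \<in> carrier (rel_quantale X)"
    have "\<Squnion>\<^bsub>rel_quantale X\<^esub>((\<lambda>a. a O b) ` A) = (\<Union>a\<in>A. a O b)"
      using A b by (intro sup) auto
    then show "(\<Squnion>\<^bsub>rel_quantale X\<^esub>A) \<otimes>\<^bsub>rel_quantale X\<^esub> b = \<Squnion>\<^bsub>rel_quantale X\<^esub>((\<lambda>a. a \<otimes>\<^bsub>rel_quantale X\<^esub> b) ` A)"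
      using A by auto
    have "\<Squnion>\<^bsub>rel_quantale X\<^esub>((\<lambda>a. b O a) ` A) = (\<Union>a\<in>A. b O a)"
      using A b by (intro sup) auto
    then show "b \<otimes>\<^bsub>rel_quantale X\<^esub> (\<Squnion>\<^bsub>rel_quantale X\<^esub>A) = \<Squnion>\<^bsub>rel_quantale X\<^esub>((\<lambda>a. b \<otimes>\<^bsub>rel_quantale X\<^esub> a) ` A)"
      using A by auto
  next
    fix A assume A: "A \<subseteq> carrier (rel_quantale X)"
    have "\<Squnion>\<^bsub>rel_quantale X\<^esub>(converse ` A) = (\<Union>a\<in>A. converse a)"
      using A by (intro sup) auto
    then show "qstar (rel_quantale X) (\<Squnion>\<^bsub>rel_quantale X\<^esub>A) = \<Squnion>\<^bsub>rel_quantale X\<^esub>(qstar (rel_quantale X) ` A)"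
      using A by auto
  qed (auto)
qed

subsection \<open>The presented quantale\<close>

lemma lang_mult_assoc: "(U \<odot> V) \<odot> W = U \<odot> (V \<odot> W)"
  unfolding lang_mult_def by (auto, metis append_assoc, metis append_assoc)

lemma lang_mult_sing [simp]: "{u} \<odot> {v} = {u @ v}"
  by (auto simp: lang_mult_def)

lemma frame_subset: "{u} \<odot> a \<odot> {v} \<subseteq> U \<longleftrightarrow> (\<forall>w\<in>a. u @ w @ v \<in> U)"
  by (auto simp: lang_mult_def)

lemma word_star_star [simp]: "word_star (word_star w) = w"
  by (induction w) (auto simp: word_star_def rev_map[symmetric] comp_def case_prod_unfold)

lemma word_star_append [simp]: "word_star (u @ v) = word_star v @ word_star u"
  by (simp add: word_star_def)

lemma word_star_lang_mult: "word_star ` (U \<odot> V) = word_star ` V \<odot> word_star ` U"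
proof (intro subset_antisym subsetI)
  fix x assume "x \<in> word_star ` (U \<odot> V)"
  then obtain u v where "u \<in> U" "v \<in> V" "x = word_star (u @ v)"
    unfolding lang_mult_def by blast
  then show "x \<in> word_star ` V \<odot> word_star ` U"
    unfolding lang_mult_def word_star_append by blast
next
  fix x assume "x \<in> word_star ` V \<odot> word_star ` U"
  then obtain u v where uv: "u \<in> U" "v \<in> V" and x: "x = word_star v @ word_star u"
    unfolding lang_mult_def by blast
  from x have "x = word_star (u @ v)" by simp
  moreover have "u @ v \<in> U \<odot> V" using uv unfolding lang_mult_def by blast
  ultimately show "x \<in> word_star ` (U \<odot> V)" by blast
qed

lemma saturated_iff:
  "saturated R U \<longleftrightarrow> (\<forall>(a, b)\<in>R. \<forall>u v.
     ((\<forall>w\<in>b. u @ w @ v \<in> U) \<longrightarrow> (\<forall>w\<in>a. u @ w @ v \<in> U)) \<and>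
     ((\<forall>w\<in>b. u @ word_star w @ v \<in> U) \<longrightarrow> (\<forall>w\<in>a. u @ word_star w @ v \<in> U)))"
  unfolding saturated_def frame_subset by simp

lemma saturatedI:
  assumes "\<And>a b u v w. \<lbrakk>(a, b) \<in> R; \<forall>w\<in>b. u @ w @ v \<in> U; w \<in> a\<rbrakk> \<Longrightarrow> u @ w @ v \<in> U"
    and "\<And>a b u v w. \<lbrakk>(a, b) \<in> R; \<forall>w\<in>b. u @ word_star w @ v \<in> U; w \<in> a\<rbrakk> \<Longrightarrow> u @ word_star w @ v \<in> U"
  shows "saturated R U"
  unfolding saturated_iff using assms by blast

lemma saturatedD:
  assumes "saturated R U" "(a, b) \<in> R" "w \<in> a"
  shows "\<forall>w\<in>b. u @ w @ v \<in> U \<Longrightarrow> u @ w @ v \<in> U"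
    and "\<forall>w\<in>b. u @ word_star w @ v \<in> U \<Longrightarrow> u @ word_star w @ v \<in> U"
  using assms unfolding saturated_iff by blast+

lemma saturated_Inter:
  assumes "\<And>V. V \<in> F \<Longrightarrow> saturated R V"
  shows "saturated R (\<Inter>F)"
proof (rule saturatedI; rule InterI)
  fix a b u v w V assume ab: "(a, b) \<in> R" "w \<in> a" and V: "V \<in> F"
  { assume "\<forall>w\<in>b. u @ w @ v \<in> \<Inter>F"
    then show "u @ w @ v \<in> V" using saturatedD(1)[OF assms[OF V] ab] V by blast }
  { assume "\<forall>w\<in>b. u @ word_star w @ v \<in> \<Inter>F"
    then show "u @ word_star w @ v \<in> V" using saturatedD(2)[OF assms[OF V] ab] V by blast }
qed

lemma saturated_saturation [simp]: "saturated R (saturation R U)"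
  unfolding saturation_def by (rule saturated_Inter) simp

lemma saturation_incl: "U \<subseteq> saturation R U"
  by (auto simp: saturation_def)

lemma saturation_least: "saturated R V \<Longrightarrow> U \<subseteq> V \<Longrightarrow> saturation R U \<subseteq> V"
  by (auto simp: saturation_def)

lemma saturation_id: "saturated R U \<Longrightarrow> saturation R U = U"
  by (meson saturation_incl saturation_least subset_antisym subset_refl)

lemma saturation_mono: "U \<subseteq> V \<Longrightarrow> saturation R U \<subseteq> saturation R V"
  by (meson saturated_saturation saturation_incl saturation_least subset_trans)

lemma saturated_left:
  assumes U: "saturated R U"
  shows "saturated R {u. \<forall>v\<in>V. u @ v \<in> U}"
proof (rule saturatedI; intro CollectI ballI)
  fix a b u w v x assume ab: "(a, b) \<in> R" "w \<in> a" and x: "x \<in> V"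
  { assume "\<forall>w\<in>b. u @ w @ v \<in> {u. \<forall>v\<in>V. u @ v \<in> U}"
    then show "(u @ w @ v) @ x \<in> U"
      using saturatedD(1)[OF U ab, of u "v @ x"] x by simp }
  { assume "\<forall>w\<in>b. u @ word_star w @ v \<in> {u. \<forall>v\<in>V. u @ v \<in> U}"
    then show "(u @ word_star w @ v) @ x \<in> U"
      using saturatedD(2)[OF U ab, of u "v @ x"] x by simp }
qed

lemma saturated_right:
  assumes U: "saturated R U"
  shows "saturated R {v. \<forall>u\<in>V. u @ v \<in> U}"
proof (rule saturatedI; intro CollectI ballI)
  fix a b u w v x assume ab: "(a, b) \<in> R" "w \<in> a" and x: "x \<in> V"
  { assume "\<forall>w\<in>b. u @ w @ v \<in> {v. \<forall>u\<in>V. u @ v \<in> U}"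
    then show "x @ u @ w @ v \<in> U"
      using saturatedD(1)[OF U ab, of "x @ u" v] x by simp }
  { assume "\<forall>w\<in>b. u @ word_star w @ v \<in> {v. \<forall>u\<in>V. u @ v \<in> U}"
    then show "x @ u @ word_star w @ v \<in> U"
      using saturatedD(2)[OF U ab, of "x @ u" v] x by simp }
qed

lemma saturated_star:
  assumes U: "saturated R U"
  shows "saturated R (word_star ` U)"
proof -
  have mem: "w \<in> word_star ` U \<longleftrightarrow> word_star w \<in> U" for w
    by (metis image_iff word_star_star)
  show ?thesis
  proof (rule saturatedI)
    fix a b u w v assume ab: "(a, b) \<in> R" "w \<in> a"
    { assume "\<forall>w\<in>b. u @ w @ v \<in> word_star ` U"
      then show "u @ w @ v \<in> word_star ` U"
        using saturatedD(2)[OF U ab, of "word_star v" "word_star u"] by (simp add: mem) }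
    { assume "\<forall>w\<in>b. u @ word_star w @ v \<in> word_star ` U"
      then show "u @ word_star w @ v \<in> word_star ` U"
        using saturatedD(1)[OF U ab, of "word_star v" "word_star u"] by (simp add: mem) }
  qed
qed

lemma saturation_mult_left: "saturation R (saturation R U \<odot> V) = saturation R (U \<odot> V)"
proof
  have "saturation R U \<subseteq> {u. \<forall>v\<in>V. u @ v \<in> saturation R (U \<odot> V)}"
    by (rule saturation_least[OF saturated_left])
       (use saturation_incl[of "U \<odot> V" R] in \<open>auto simp: lang_mult_def\<close>)
  then have "saturation R U \<odot> V \<subseteq> saturation R (U \<odot> V)"
    by (auto simp: lang_mult_def)
  then show "saturation R (saturation R U \<odot> V) \<subseteq> saturation R (U \<odot> V)"
    by (rule saturation_least[OF saturated_saturation])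
  show "saturation R (U \<odot> V) \<subseteq> saturation R (saturation R U \<odot> V)"
    by (rule saturation_mono) (use saturation_incl[of U R] in \<open>auto simp: lang_mult_def\<close>)
qed

lemma saturation_mult_right: "saturation R (U \<odot> saturation R V) = saturation R (U \<odot> V)"
proof
  have "saturation R V \<subseteq> {v. \<forall>u\<in>U. u @ v \<in> saturation R (U \<odot> V)}"
    by (rule saturation_least[OF saturated_right])
       (use saturation_incl[of "U \<odot> V" R] in \<open>auto simp: lang_mult_def\<close>)
  then have "U \<odot> saturation R V \<subseteq> saturation R (U \<odot> V)"
    by (auto simp: lang_mult_def)
  then show "saturation R (U \<odot> saturation R V) \<subseteq> saturation R (U \<odot> V)"
    by (rule saturation_least[OF saturated_saturation])
  show "saturation R (U \<odot> V) \<subseteq> saturation R (U \<odot> saturation R V)"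
    by (rule saturation_mono) (use saturation_incl[of V R] in \<open>auto simp: lang_mult_def\<close>)
qed

lemma saturation_star: "saturation R (word_star ` U) = word_star ` saturation R U"
proof -
  have sub: "saturation R (word_star ` U) \<subseteq> word_star ` saturation R U" for U
    by (rule saturation_least[OF saturated_star[OF saturated_saturation]])
       (use saturation_incl[of U R] in auto)
  have "word_star ` saturation R (word_star ` (word_star ` U)) \<subseteq> word_star ` word_star ` saturation R (word_star ` U)"
    using sub[of "word_star ` U"] by (rule image_mono)
  then show ?thesis using sub[of U] by (auto simp: image_comp comp_def)
qed

lemma saturation_UN: "saturation R (\<Union>U\<in>F. saturation R (f U)) = saturation R (\<Union>U\<in>F. f U)"
proof
  have "saturation R (f U) \<subseteq> saturation R (\<Union>U\<in>F. f U)" if "U \<in> F" for U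
    using that by (intro saturation_mono) auto
  then show "saturation R (\<Union>U\<in>F. saturation R (f U)) \<subseteq> saturation R (\<Union>U\<in>F. f U)"
    by (intro saturation_least[OF saturated_saturation]) auto
  show "saturation R (\<Union>U\<in>F. f U) \<subseteq> saturation R (\<Union>U\<in>F. saturation R (f U))"
    by (rule saturation_mono) (use saturation_incl[of _ R] in blast)
qed

lemma presented_quantale_simps [simp]:
  "carrier (presented_quantale R) = {U. saturated R U}" "eq (presented_quantale R) = (=)"
  "le (presented_quantale R) = (\<subseteq>)"
  "qmult (presented_quantale R) = (\<lambda>U V. saturation R (U \<odot> V))"
  "qunit (presented_quantale R) = saturation R {[]}"
  "qstar (presented_quantale R) = (`) word_star"
  by (simp_all add: presented_quantale_def)

lemma presented_quantale_least:
  assumes "A \<subseteq> {U. saturated R U}"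
  shows "least (presented_quantale R) (saturation R (\<Union>A)) (Upper (presented_quantale R) A)"
proof -
  have "x \<subseteq> saturation R (\<Union>A)" if "x \<in> A" for x
    using that saturation_incl[of "\<Union>A" R] by blast
  moreover have "saturation R (\<Union>A) \<subseteq> V" if "\<forall>x\<in>A. x \<subseteq> V" "saturated R V" for V
    using that saturation_least[of R V "\<Union>A"] by blast
  ultimately show ?thesis
    unfolding least_def Upper_def using assms by (simp add: subset_iff[of A])
qed

lemma presented_quantale_sup [simp]:
  "A \<subseteq> {U. saturated R U} \<Longrightarrow> \<Squnion>\<^bsub>presented_quantale R\<^esub>A = saturation R (\<Union>A)"
  by (rule sup_eqI) (simp_all add: presented_quantale_least)

theorem quantale_presented_quantale: "quantale (presented_quantale R)"
proof -
  interpret complete_lattice "presented_quantale R"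
    by (rule complete_lattice_setI[where s = "\<lambda>A. saturation R (\<Union>A)"])
       (simp_all add: presented_quantale_least)
  have sup: "\<Squnion>\<^bsub>presented_quantale R\<^esub>(f ` A) = saturation R (\<Union>(f ` A))"
    if "A \<subseteq> {U. saturated R U}" "\<And>a. saturated R a \<Longrightarrow> saturated R (f a)" for f :: "'a word set \<Rightarrow> _" and A
    using that by (intro presented_quantale_sup) auto
  have lm_Union: "(\<Union>A) \<odot> b = (\<Union>a\<in>A. a \<odot> b)" "b \<odot> (\<Union>A) = (\<Union>a\<in>A. b \<odot> a)"
    for A and b :: "'a word set"
    by (auto simp: lang_mult_def)
  have unit: "{[]} \<odot> a = a" "a \<odot> {[]} = a" for a :: "'a word set"
    by (auto simp: lang_mult_def)
  show ?thesis
    by unfold_locales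
       (simp_all add: sup saturated_star saturation_mult_left saturation_mult_right lang_mult_assoc
          unit saturation_id lm_Union saturation_UN saturation_star[symmetric] image_Union word_star_lang_mult image_comp)
qed

subsection \<open>The universal property\<close>

lemma (in quantale) sup_upper': "A \<subseteq> carrier Q \<Longrightarrow> a \<in> A \<Longrightarrow> a \<sqsubseteq> \<Squnion>A"
  by (rule supI) (auto simp: least_def Upper_def)

lemma (in quantale) sup_least':
  "A \<subseteq> carrier Q \<Longrightarrow> (\<And>a. a \<in> A \<Longrightarrow> a \<sqsubseteq> q) \<Longrightarrow> q \<in> carrier Q \<Longrightarrow> \<Squnion>A \<sqsubseteq> q"
  by (rule supI) (auto simp: least_def Upper_def)

lemma (in quantale) sup_le_iff:
  assumes "A \<subseteq> carrier Q" "q \<in> carrier Q"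
  shows "\<Squnion>A \<sqsubseteq> q \<longleftrightarrow> (\<forall>a\<in>A. a \<sqsubseteq> q)"
  using assms by (meson le_trans subsetD sup_closed sup_least' sup_upper')

lemma (in quantale) eqI:
  assumes "a \<in> carrier Q" "b \<in> carrier Q" "\<And>q. q \<in> carrier Q \<Longrightarrow> a \<sqsubseteq> q \<longleftrightarrow> b \<sqsubseteq> q"
  shows "a = b"
  using assms by (meson le_antisym le_refl)

lemma (in quantale) mult_left_mono:
  assumes "a \<sqsubseteq> b" "a \<in> carrier Q" "b \<in> carrier Q" "c \<in> carrier Q"
  shows "c \<otimes> a \<sqsubseteq> c \<otimes> b"
proof -
  have "\<Squnion>{a, b} = b"
    by (rule eqI) (use assms le_trans in \<open>auto simp: sup_le_iff\<close>)
  then have "c \<otimes> b = \<Squnion>{c \<otimes> a, c \<otimes> b}"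
    using mult_sup[of "{a, b}" c] assms by simp
  then show ?thesis
    using sup_upper'[of "{c \<otimes> a, c \<otimes> b}" "c \<otimes> a"] assms mult_closed by simp
qed

lemma (in quantale) mult_right_mono:
  assumes "a \<sqsubseteq> b" "a \<in> carrier Q" "b \<in> carrier Q" "c \<in> carrier Q"
  shows "a \<otimes> c \<sqsubseteq> b \<otimes> c"
proof -
  have "\<Squnion>{a, b} = b"
    by (rule eqI) (use assms le_trans in \<open>auto simp: sup_le_iff\<close>)
  then have "b \<otimes> c = \<Squnion>{a \<otimes> c, b \<otimes> c}"
    using sup_mult[of "{a, b}" c] assms by simp
  then show ?thesis
    using sup_upper'[of "{a \<otimes> c, b \<otimes> c}" "a \<otimes> c"] assms mult_closed by simp
qed

lemma (in quantale) star_mono: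
  assumes "a \<sqsubseteq> b" "a \<in> carrier Q" "b \<in> carrier Q"
  shows "qstar Q a \<sqsubseteq> qstar Q b"
proof -
  have "\<Squnion>{a, b} = b"
    by (rule eqI) (use assms le_trans in \<open>auto simp: sup_le_iff\<close>)
  then have "qstar Q b = \<Squnion>{qstar Q a, qstar Q b}"
    using star_sup[of "{a, b}"] assms by simp
  then show ?thesis
    using sup_upper'[of "{qstar Q a, qstar Q b}" "qstar Q a"] assms star_closed by simp
qed

lemma (in quantale) star_unit: "qstar Q (qunit Q) = qunit Q"
  by (metis star_closed star_mult star_star unit_closed unit_left unit_right)

context quantale
begin

context
  fixes \<gamma> :: "'g \<Rightarrow> 'a"
  assumes \<gamma>: "\<And>g. \<gamma> g \<in> carrier Q"
begin

lemma eval_closed [simp]: "eval_word Q \<gamma> w \<in> carrier Q"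
  by (induction w) (auto simp: \<gamma> unit_closed mult_closed star_closed)

lemma eval_image_closed: "eval_word Q \<gamma> ` U \<subseteq> carrier Q"
  by auto

lemma eval_lang_closed [simp]: "eval_lang Q \<gamma> U \<in> carrier Q"
  unfolding eval_lang_def by (rule sup_closed) auto

lemma eval_append: "eval_word Q \<gamma> (u @ v) = eval_word Q \<gamma> u \<otimes> eval_word Q \<gamma> v"
  by (induction u) (auto simp: unit_left mult_assoc \<gamma> star_closed)

lemma eval_star: "eval_word Q \<gamma> (word_star w) = qstar Q (eval_word Q \<gamma> w)"
proof (induction w)
  case Nil
  then show ?case by (simp add: word_star_def star_unit)
next
  case (Cons x w)
  obtain g b where x: "x = (g, b)" by (cases x)
  have "word_star (x # w) = word_star w @ [(g, \<not> b)]" by (simp add: word_star_def x)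
  then show ?case
    by (simp add: eval_append Cons.IH x star_mult \<gamma> star_closed star_star unit_right)
qed

lemma eval_lang_le: "q \<in> carrier Q \<Longrightarrow> eval_lang Q \<gamma> U \<sqsubseteq> q \<longleftrightarrow> (\<forall>w\<in>U. eval_word Q \<gamma> w \<sqsubseteq> q)"
  unfolding eval_lang_def by (subst sup_le_iff) auto

lemma eval_lang_mult: "eval_lang Q \<gamma> (U \<odot> V) = eval_lang Q \<gamma> U \<otimes> eval_lang Q \<gamma> V"
proof -
  have "eval_lang Q \<gamma> U \<otimes> eval_lang Q \<gamma> V = \<Squnion>((\<lambda>x. x \<otimes> eval_lang Q \<gamma> V) ` eval_word Q \<gamma> ` U)"
    unfolding eval_lang_def[of Q \<gamma> U] by (rule sup_mult) auto
  also have "\<dots> = \<Squnion>((\<lambda>u. \<Squnion>((\<lambda>v. eval_word Q \<gamma> (u @ v)) ` V)) ` U)"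
  proof -
    have "eval_word Q \<gamma> u \<otimes> eval_lang Q \<gamma> V = \<Squnion>((\<lambda>v. eval_word Q \<gamma> (u @ v)) ` V)" for u
      unfolding eval_lang_def by (subst mult_sup) (auto simp: image_image eval_append)
    then show ?thesis by (simp add: image_image)
  qed
  also have "\<dots> = eval_lang Q \<gamma> (U \<odot> V)"
  proof (rule eqI)
    have cl: "(\<lambda>v. eval_word Q \<gamma> (u @ v)) ` V \<subseteq> carrier Q" for u by auto
    then have cl2: "(\<lambda>u. \<Squnion>((\<lambda>v. eval_word Q \<gamma> (u @ v)) ` V)) ` U \<subseteq> carrier Q" by auto
    then show "\<Squnion>((\<lambda>u. \<Squnion>((\<lambda>v. eval_word Q \<gamma> (u @ v)) ` V)) ` U) \<in> carrier Q" by simp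
    fix q assume "q \<in> carrier Q"
    then show "\<Squnion>((\<lambda>u. \<Squnion>((\<lambda>v. eval_word Q \<gamma> (u @ v)) ` V)) ` U) \<sqsubseteq> q \<longleftrightarrow> eval_lang Q \<gamma> (U \<odot> V) \<sqsubseteq> q"
      using cl cl2 by (simp add: sup_le_iff eval_lang_le lang_mult_def) blast
  qed simp
  finally show ?thesis by simp
qed

lemma eval_lang_star: "eval_lang Q \<gamma> (word_star ` U) = qstar Q (eval_lang Q \<gamma> U)"
  unfolding eval_lang_def by (subst star_sup) (auto simp: image_image eval_star)

lemma saturated_below:
  assumes R: "satisfies_relations Q \<gamma> R" and q: "q \<in> carrier Q"
  shows "saturated R {w. eval_word Q \<gamma> w \<sqsubseteq> q}"
proof -
  have iff: "{u} \<odot> a \<odot> {v} \<subseteq> {w. eval_word Q \<gamma> w \<sqsubseteq> q} \<longleftrightarrow>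
      eval_word Q \<gamma> u \<otimes> eval_lang Q \<gamma> a \<otimes> eval_word Q \<gamma> v \<sqsubseteq> q" for u v a
  proof -
    have "{u} \<odot> a \<odot> {v} \<subseteq> {w. eval_word Q \<gamma> w \<sqsubseteq> q} \<longleftrightarrow> eval_lang Q \<gamma> ({u} \<odot> a \<odot> {v}) \<sqsubseteq> q"
      using q by (auto simp: eval_lang_le)
    moreover have "eval_lang Q \<gamma> {w} = eval_word Q \<gamma> w" for w
      by (rule eqI) (auto simp: eval_lang_le)
    ultimately show ?thesis by (simp add: eval_lang_mult)
  qed
  have step: "eval_word Q \<gamma> u \<otimes> x \<otimes> eval_word Q \<gamma> v \<sqsubseteq> q"
    if "x \<sqsubseteq> y" "x \<in> carrier Q" "y \<in> carrier Q" "eval_word Q \<gamma> u \<otimes> y \<otimes> eval_word Q \<gamma> v \<sqsubseteq> q" for u v x y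
  proof -
    have "eval_word Q \<gamma> u \<otimes> x \<otimes> eval_word Q \<gamma> v \<sqsubseteq> eval_word Q \<gamma> u \<otimes> y \<otimes> eval_word Q \<gamma> v"
      using that by (intro mult_right_mono mult_left_mono) (auto simp: mult_closed)
    then show ?thesis
      using that q by (meson eval_closed le_trans mult_closed)
  qed
  have ab: "eval_lang Q \<gamma> a \<sqsubseteq> eval_lang Q \<gamma> b" if "(a, b) \<in> R" for a b
    using R that by (auto simp: satisfies_relations_def)
  then have "eval_lang Q \<gamma> (word_star ` a) \<sqsubseteq> eval_lang Q \<gamma> (word_star ` b)" if "(a, b) \<in> R" for a b
    using that by (simp add: eval_lang_star star_mono)
  with ab show ?thesis
    unfolding saturated_def iff using step by (auto split: prod.splits) (meson eval_lang_closed)+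
qed

lemma eval_saturation:
  assumes R: "satisfies_relations Q \<gamma> R"
  shows "eval_lang Q \<gamma> (saturation R U) = eval_lang Q \<gamma> U"
proof (rule eqI)
  fix q assume q: "q \<in> carrier Q"
  have "U \<subseteq> {w. eval_word Q \<gamma> w \<sqsubseteq> q} \<longleftrightarrow> saturation R U \<subseteq> {w. eval_word Q \<gamma> w \<sqsubseteq> q}"
    using saturation_least[OF saturated_below[OF R q], of U] saturation_incl[of U R] by blast
  then show "eval_lang Q \<gamma> (saturation R U) \<sqsubseteq> q \<longleftrightarrow> eval_lang Q \<gamma> U \<sqsubseteq> q"
    using q by (auto simp: eval_lang_le)
qed auto

lemma eval_lang_sing [simp]: "eval_lang Q \<gamma> {w} = eval_word Q \<gamma> w"
  by (rule eqI) (auto simp: eval_lang_le)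

theorem presented_quantale_exists:
  assumes R: "satisfies_relations Q \<gamma> R"
  shows "strictly_unital_hom (presented_quantale R) Q (eval_lang Q \<gamma>)"
    and "eval_lang Q \<gamma> (presented_gen R g) = \<gamma> g"
proof -
  have "eval_lang Q \<gamma> (\<Union>A) = \<Squnion>(eval_lang Q \<gamma> ` A)" for A
  proof (rule eqI)
    have cl: "eval_lang Q \<gamma> ` A \<subseteq> carrier Q" by auto
    then show "\<Squnion>(eval_lang Q \<gamma> ` A) \<in> carrier Q" by simp
    fix q assume "q \<in> carrier Q"
    then show "eval_lang Q \<gamma> (\<Union>A) \<sqsubseteq> q \<longleftrightarrow> \<Squnion>(eval_lang Q \<gamma> ` A) \<sqsubseteq> q"
      using cl by (auto simp: sup_le_iff eval_lang_le)
  qed simp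
  then show "strictly_unital_hom (presented_quantale R) Q (eval_lang Q \<gamma>)"
    unfolding strictly_unital_hom_def quantale_hom_def
    by (auto simp: eval_saturation[OF R] eval_lang_mult eval_lang_star unit_closed)
  show "eval_lang Q \<gamma> (presented_gen R g) = \<gamma> g"
    by (simp add: presented_gen_def eval_saturation[OF R] unit_right \<gamma>)
qed

end

lemma hom_sup:
  assumes "quantale_hom P Q h" "A \<subseteq> carrier P"
  shows "h (\<Squnion>\<^bsub>P\<^esub>A) = \<Squnion>(h ` A)"
proof -
  from assms(1) have "\<forall>A. A \<subseteq> carrier P \<longrightarrow> h (\<Squnion>\<^bsub>P\<^esub>A) = \<Squnion>(h ` A)"
    unfolding quantale_hom_def by (elim conjE)
  from this[THEN spec, THEN mp, OF assms(2)] show ?thesis .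
qed

lemma hom_determined_by_gens:
  assumes h: "quantale_hom (presented_quantale R) Q h"
    and k: "quantale_hom (presented_quantale R) Q k"
    and unit: "h (saturation R {[]}) = k (saturation R {[]})"
    and gen: "\<And>g. h (presented_gen R g) = k (presented_gen R g)"
    and U: "saturated R U"
  shows "h U = k U"
proof -
  let ?P = "presented_quantale R"
  have words: "h (saturation R {w}) = k (saturation R {w})" for w
  proof (induction w)
    case Nil
    show ?case by (rule unit)
  next
    case (Cons x w)
    obtain g b where x: "x = (g, b)" by (cases x)
    let ?g = "if b then word_star ` presented_gen R g else presented_gen R g"
    have g: "?g = saturation R {[x]}"
      using saturation_star[of R "{[(g, False)]}"] by (auto simp: presented_gen_def x word_star_def)
    have hg: "h ?g = k ?g"
      using h k gen[of g] by (auto simp: quantale_hom_def presented_gen_def)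
    have split: "saturation R {x # w} = ?g \<otimes>\<^bsub>?P\<^esub> saturation R {w}"
      unfolding g by (simp add: saturation_mult_left saturation_mult_right)
    have cl: "?g \<in> carrier ?P" "saturation R {w} \<in> carrier ?P" unfolding g by auto
    have "h (?g \<otimes>\<^bsub>?P\<^esub> saturation R {w}) = h ?g \<otimes> h (saturation R {w})"
      using h cl unfolding quantale_hom_def by blast
    moreover have "k (?g \<otimes>\<^bsub>?P\<^esub> saturation R {w}) = k ?g \<otimes> k (saturation R {w})"
      using k cl unfolding quantale_hom_def by blast
    ultimately show ?case
      by (simp only: split hg Cons.IH)
  qed
  let ?A = "(\<lambda>w. saturation R {w}) ` U"
  have A: "?A \<subseteq> carrier ?P" by auto
  have "\<Squnion>\<^bsub>?P\<^esub>?A = U"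
    using A saturation_UN[of R "\<lambda>w. {w}" U] U by (simp add: saturation_id)
  moreover have "h (\<Squnion>\<^bsub>?P\<^esub>?A) = \<Squnion>(h ` ?A)" "k (\<Squnion>\<^bsub>?P\<^esub>?A) = \<Squnion>(k ` ?A)"
    using hom_sup[OF h A] hom_sup[OF k A] .
  moreover have "h ` ?A = k ` ?A" by (auto simp: image_image words)
  ultimately show ?thesis by metis
qed

theorem presented_quantale_unique:
  assumes h: "strictly_unital_hom (presented_quantale R) Q h"
    and k: "strictly_unital_hom (presented_quantale R) Q k"
    and gen: "\<And>g. h (presented_gen R g) = k (presented_gen R g)"
    and U: "U \<in> carrier (presented_quantale R)"
  shows "h U = k U"
  by (rule hom_determined_by_gens[of R]) (use assms in \<open>auto simp: strictly_unital_hom_def\<close>)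

end

theorem presented_quantale_satisfies_relations:
  "satisfies_relations (presented_quantale R) (presented_gen R) R"
proof -
  interpret P: quantale "presented_quantale R" by (rule quantale_presented_quantale)
  have gen: "\<And>g. presented_gen R g \<in> carrier (presented_quantale R)" by (simp add: presented_gen_def)
  have w: "eval_word (presented_quantale R) (presented_gen R) w = saturation R {w}" for w
  proof (induction w)
    case (Cons x w)
    obtain g b where x: "x = (g, b)" by (cases x)
    have "(if b then word_star ` presented_gen R g else presented_gen R g) = saturation R {[x]}"
      using saturation_star[of R "{[(g, False)]}"] by (auto simp: presented_gen_def x word_star_def)
    then show ?case using Cons.IH
      by (auto simp: x saturation_mult_left saturation_mult_right split: if_splits)
  qed simp
  have lang: "eval_lang (presented_quantale R) (presented_gen R) U = saturation R U" for U
  proof -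
    have "eval_lang (presented_quantale R) (presented_gen R) U = saturation R (\<Union>w\<in>U. saturation R {w})"
      unfolding eval_lang_def w by (subst presented_quantale_sup) auto
    then show ?thesis using saturation_UN[of R "\<lambda>w. {w}" U] by simp
  qed
  have "a \<subseteq> saturation R b" if "(a, b) \<in> R" for a b
  proof -
    have "saturated R (saturation R b)" by simp
    then have "(\<forall>w\<in>b. [] @ w @ [] \<in> saturation R b) \<longrightarrow> (\<forall>w\<in>a. [] @ w @ [] \<in> saturation R b)"
      using that unfolding saturated_iff by blast
    then show ?thesis using saturation_incl[of b R] by auto
  qed
  then have "saturation R a \<subseteq> saturation R b" if "(a, b) \<in> R" for a b
    using that by (intro saturation_least[OF saturated_saturation])
  then show ?thesis
    unfolding satisfies_relations_def lang by clarify simp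
qed


section \<open>The quantale Pen\<close>

datatype tile = S | L

text \<open>\<open>bra A n\<close> and \<open>ket A n\<close> are the generator \<open>(A, n)\<close> and its adjoint, as elements of the free
  quantale.\<close>

type_synonym pen_gen = "tile \<times> nat"

definition bra :: "tile \<Rightarrow> nat \<Rightarrow> pen_gen word set" where
  "bra A n = {[((A, n), False)]}"

definition ket :: "tile \<Rightarrow> nat \<Rightarrow> pen_gen word set" where
  "ket A n = {[((A, n), True)]}"

fun bras :: "(nat \<Rightarrow> tile) \<Rightarrow> nat \<Rightarrow> pen_gen word set" where
  "bras A 0 = bra (A 0) 0"
| "bras A (Suc n) = bra (A (Suc n)) (Suc n) \<odot> bras A n"

fun kets :: "(nat \<Rightarrow> tile) \<Rightarrow> nat \<Rightarrow> pen_gen word set" where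
  "kets A 0 = ket (A 0) 0"
| "kets A (Suc n) = kets A n \<odot> ket (A (Suc n)) (Suc n)"

definition admissible :: "(nat \<Rightarrow> tile) \<Rightarrow> nat \<Rightarrow> bool" where
  "admissible A n \<longleftrightarrow> (\<forall>i<n. A i = S \<longrightarrow> A (Suc i) = L)"

text \<open>In the free quantale the unit is \<open>{[]}\<close>, the bottom is \<open>{}\<close> and binary joins are unions.\<close>

inductive_set pen_relations :: "(pen_gen word set \<times> pen_gen word set) set" where
  C1: "(bra L n \<odot> ket S n, {}) \<in> pen_relations"
| C2: "(bra S n, bra L (n + 1)) \<in> pen_relations"
| D1: "({[]}, bra L n \<union> bra S n) \<in> pen_relations"
| D2: "(ket A (n + 1) \<odot> bra A (n + 1), bra S n \<union> bra L n) \<in> pen_relations"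
| E1: "(bra B n \<odot> bra A (n + 1), bra A (n + 1)) \<in> pen_relations"
| E2: "(bra A (n + 1) \<odot> bra B n, bra A (n + 1)) \<in> pen_relations"
| E3: "(ket B n \<odot> bra A (n + 1), bra A (n + 1)) \<in> pen_relations"
| E4: "(bra A (n + 1) \<odot> ket B n, bra A (n + 1)) \<in> pen_relations"
| C': "admissible A n \<Longrightarrow> A n = L \<Longrightarrow> ({[]}, bras A n \<odot> kets A n) \<in> pen_relations"

definition Pen :: "pen_gen word set quantale" where
  "Pen = presented_quantale pen_relations"

definition pen_bra :: "tile \<Rightarrow> nat \<Rightarrow> pen_gen word set" where
  "pen_bra A n = presented_gen pen_relations (A, n)"


section \<open>The Cantor representation\<close>

definition penrose_sequences :: "(nat \<Rightarrow> nat) set" where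
  "penrose_sequences = {s. (\<forall>n. s n \<in> {0, 1}) \<and> (\<forall>n. s n = 1 \<longrightarrow> s (n + 1) = 0)}"

fun cantor_gen :: "pen_gen \<Rightarrow> ((nat \<Rightarrow> nat) \<times> (nat \<Rightarrow> nat)) set" where
  "cantor_gen (L, n) = {(s, t). s \<in> penrose_sequences \<and> t \<in> penrose_sequences \<and>
     t n = 0 \<and> (\<forall>m>n. s m = t m)}"
| "cantor_gen (S, n) = {(s, t). s \<in> penrose_sequences \<and> t \<in> penrose_sequences \<and>
     t n = 1 \<and> (\<forall>m>n. s m = t m)}"

text \<open>The homomorphism that the universal property assigns to \<open>cantor_gen\<close>; by the
  lemmas \<open>cantor_rep\<close> and \<open>cantor_rep_unique\<close> below it is the only relational representation with
  the prescribed values on the generators.\<close>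

definition cantor_rep :: "pen_gen word set \<Rightarrow> ((nat \<Rightarrow> nat) \<times> (nat \<Rightarrow> nat)) set" where
  "cantor_rep = eval_lang (rel_quantale penrose_sequences) cantor_gen"

definition tile_val :: "tile \<Rightarrow> nat" where
  "tile_val A = (case A of L \<Rightarrow> 0 | S \<Rightarrow> 1)"

lemma cantor_gen_iff:
  "(s, t) \<in> cantor_gen (A, n) \<longleftrightarrow> s \<in> penrose_sequences \<and> t \<in> penrose_sequences \<and>
     t n = tile_val A \<and> (\<forall>m>n. s m = t m)"
  by (cases A) (auto simp: tile_val_def)

lemma cantor_gen_closed: "cantor_gen g \<in> carrier (rel_quantale penrose_sequences)"
  by (cases g) (auto simp: cantor_gen_iff)

lemma cantor_bras:
  "s \<in> penrose_sequences \<Longrightarrow> admissible A n \<Longrightarrow> (A n = S \<longrightarrow> s (Suc n) = 0) \<Longrightarrow>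
   \<exists>t. (s, t) \<in> eval_lang (rel_quantale penrose_sequences) cantor_gen (bras A n)"
proof (induction n arbitrary: s)
  case 0
  interpret quantale "rel_quantale penrose_sequences" by (rule quantale_rel_quantale)
  let ?t = "s(0 := tile_val (A 0))"
  have "?t \<in> penrose_sequences"
    using 0 by (cases "A 0") (auto simp: penrose_sequences_def tile_val_def)
  then have "(s, ?t) \<in> cantor_gen (A 0, 0)" using 0 by (auto simp: cantor_gen_iff)
  then show ?case
    using 0 cantor_gen_closed[of "(A 0, 0)"]
    by (auto simp: bra_def eval_lang_sing[OF cantor_gen_closed] relcomp_unfold)
next
  case (Suc n)
  interpret quantale "rel_quantale penrose_sequences" by (rule quantale_rel_quantale)
  let ?t = "\<lambda>i. if i < Suc n then 0 else if i = Suc n then tile_val (A (Suc n)) else s i"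
  have t: "?t \<in> penrose_sequences"
    using Suc.prems by (cases "A (Suc n)") (auto simp: penrose_sequences_def tile_val_def)
  have "A n = S \<longrightarrow> ?t (Suc n) = 0"
    using Suc.prems by (auto simp: admissible_def tile_val_def)
  then obtain u where u: "(?t, u) \<in> eval_lang (rel_quantale penrose_sequences) cantor_gen (bras A n)"
    using Suc.IH[OF t] Suc.prems by (auto simp: admissible_def)
  have "(s, ?t) \<in> cantor_gen (A (Suc n), Suc n)"
    using t Suc.prems by (auto simp: cantor_gen_iff)
  then have "(s, ?t) \<in> eval_lang (rel_quantale penrose_sequences) cantor_gen (bra (A (Suc n)) (Suc n))"
    using t by (auto simp: bra_def eval_lang_sing[OF cantor_gen_closed] relcomp_unfold)
  with u show ?case
    by (auto simp: eval_lang_mult[OF cantor_gen_closed] relcomp_unfold)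
qed

lemma kets_star: "kets A n = word_star ` bras A n"
proof (induction n)
  case (Suc n)
  have "word_star ` bra A n = ket A n" for A n by (simp add: bra_def ket_def word_star_def)
  then show ?case by (simp add: Suc word_star_lang_mult)
qed (simp add: bra_def ket_def word_star_def)

lemma cantor_relations:
  "satisfies_relations (rel_quantale penrose_sequences) cantor_gen pen_relations"
proof -
  interpret quantale "rel_quantale penrose_sequences" by (rule quantale_rel_quantale)
  let ?K = "rel_quantale penrose_sequences"
  let ?e = "eval_lang ?K cantor_gen"
  note mult = eval_lang_mult[OF cantor_gen_closed]
  have bra: "?e (bra A n) = cantor_gen (A, n)" for A n
    using cantor_gen_closed[of "(A, n)"]
    by (auto simp: bra_def eval_lang_sing[OF cantor_gen_closed] relcomp_unfold)
  have ket: "?e (ket A n) = (cantor_gen (A, n))\<inverse>" for A n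
    using cantor_gen_closed[of "(A, n)"]
    by (auto simp: ket_def eval_lang_sing[OF cantor_gen_closed] relcomp_unfold)
  have Un: "?e (U \<union> V) = ?e U \<union> ?e V" for U V
  proof -
    have "eval_word ?K cantor_gen ` U \<subseteq> Pow (penrose_sequences \<times> penrose_sequences)" for U
      using eval_image_closed[of cantor_gen U, OF cantor_gen_closed] by simp
    then show ?thesis by (simp add: eval_lang_def image_Un)
  qed
  have e: "?e {[]} = Id_on penrose_sequences"
    by (simp add: eval_lang_sing[OF cantor_gen_closed])
  have K_01: "s n = 0 \<or> s n = Suc 0" if "s \<in> penrose_sequences" for s n
    using that by (simp add: penrose_sequences_def)
  have K_step: "s (Suc n) = 0" if "s \<in> penrose_sequences" "s n = Suc 0" for s n
    using that by (simp add: penrose_sequences_def)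
  have "?e a \<subseteq> ?e b" if "(a, b) \<in> pen_relations" for a b
    using that
  proof cases
    case (C1 n)
    then show ?thesis by (auto simp: mult bra ket)
  next
    case (C2 n)
    show ?thesis unfolding C2 bra by (auto simp: K_step)
  next
    case (D1 n)
    show ?thesis unfolding D1 e Un bra using K_01 by auto
  next
    case (D2 A n)
    have "(s, u) \<in> cantor_gen (S, n) \<union> cantor_gen (L, n)"
      if ts: "(t, s) \<in> cantor_gen (A, n + 1)" and tu: "(t, u) \<in> cantor_gen (A, n + 1)" for s t u
    proof -
      have "s m = u m" if "m > n" for m
        using that ts tu by (cases "m = n + 1") (auto simp: cantor_gen_iff)
      then show ?thesis
        using ts tu K_01[of u n] by (auto simp: cantor_gen_iff)
    qed
    then show ?thesis unfolding D2 mult Un bra ket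
      by (simp only: rel_quantale_simps) blast
  next
    case (E1 B n A)
    then show ?thesis by (auto simp: mult bra cantor_gen_iff simp del: cantor_gen.simps)
  next
    case (E2 A n B)
    then show ?thesis
      by (auto simp: mult bra cantor_gen_iff simp del: cantor_gen.simps)
  next
    case (E3 B n A)
    then show ?thesis by (auto simp: mult bra ket cantor_gen_iff simp del: cantor_gen.simps)
  next
    case (E4 A n B)
    then show ?thesis by (auto simp: mult bra ket cantor_gen_iff simp del: cantor_gen.simps)
  next
    case (C' A n)
    have "(s, s) \<in> ?e (bras A n) O (?e (bras A n))\<inverse>" if "s \<in> penrose_sequences" for s
      using cantor_bras[OF that C'(3)] C'(4) by auto
    then show ?thesis
      unfolding C' e mult kets_star eval_lang_star[OF cantor_gen_closed] by auto
  qed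
  then show ?thesis by (auto simp: satisfies_relations_def)
qed

theorem cantor_rep:
  "relational_rep Pen penrose_sequences cantor_rep"
  "cantor_rep (pen_bra A n) = cantor_gen (A, n)"
proof -
  interpret quantale "rel_quantale penrose_sequences" by (rule quantale_rel_quantale)
  note ex = presented_quantale_exists[OF cantor_gen_closed cantor_relations]
  show "relational_rep Pen penrose_sequences cantor_rep"
    using ex(1) by (simp add: relational_rep_def Pen_def cantor_rep_def strictly_unital_hom_def)
  show "cantor_rep (pen_bra A n) = cantor_gen (A, n)"
    using ex(2) by (simp add: pen_bra_def cantor_rep_def)
qed

theorem cantor_rep_unique:
  assumes r: "relational_rep Pen penrose_sequences r"
    and gen: "\<And>A n. r (pen_bra A n) = cantor_gen (A, n)"
    and U: "U \<in> carrier Pen"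
  shows "r U = cantor_rep U"
proof -
  interpret quantale "rel_quantale penrose_sequences" by (rule quantale_rel_quantale)
  interpret P: quantale Pen unfolding Pen_def by (rule quantale_presented_quantale)
  have rh: "quantale_hom Pen (rel_quantale penrose_sequences) r"
    using r by (simp add: relational_rep_def)
  have gens: "pen_bra A n \<in> carrier Pen" for A n
    by (simp add: pen_bra_def Pen_def presented_gen_def)
  have unit_r: "q (qunit Pen) = Id_on penrose_sequences"
    if q: "quantale_hom Pen (rel_quantale penrose_sequences) q"
      and g: "\<And>A n. q (pen_bra A n) = cantor_gen (A, n)" for q
  proof
    let ?d = "q (qunit Pen)"
    show "Id_on penrose_sequences \<subseteq> ?d" using q by (simp add: quantale_hom_def)
    have D1: "qunit Pen \<sqsubseteq>\<^bsub>Pen\<^esub> \<Squnion>\<^bsub>Pen\<^esub>{pen_bra L 0, pen_bra S 0}"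
    proof -
      have "satisfies_relations Pen (presented_gen pen_relations) pen_relations"
        unfolding Pen_def by (rule presented_quantale_satisfies_relations)
      then have "eval_lang Pen (presented_gen pen_relations) {[]} \<sqsubseteq>\<^bsub>Pen\<^esub>
          eval_lang Pen (presented_gen pen_relations) (bra L 0 \<union> bra S 0)"
        unfolding satisfies_relations_def using pen_relations.D1[of 0] by fast
      moreover have "presented_gen pen_relations x \<in> carrier Pen" for x
        by (simp add: Pen_def presented_gen_def)
      ultimately show ?thesis
        by (simp add: P.eval_lang_sing) (simp add: eval_lang_def bra_def pen_bra_def P.unit_right insert_commute)
    qed
    have "?d \<subseteq> cantor_gen (L, 0) \<union> cantor_gen (S, 0)"
    proof -
      let ?m = "\<Squnion>\<^bsub>Pen\<^esub>{pen_bra L 0, pen_bra S 0}"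
      have m: "?m \<in> carrier Pen" using gens by (intro P.sup_closed) simp
      have em: "\<Squnion>\<^bsub>Pen\<^esub>{qunit Pen, ?m} = ?m"
        by (rule P.eqI)
           (use D1 m P.unit_closed P.le_trans[OF D1] in \<open>auto simp: P.sup_le_iff\<close>)
      have sup: "q (\<Squnion>\<^bsub>Pen\<^esub>{a, b}) = q a \<union> q b" if "a \<in> carrier Pen" "b \<in> carrier Pen" for a b
      proof -
        have "q a \<in> Pow (penrose_sequences \<times> penrose_sequences)"
          "q b \<in> Pow (penrose_sequences \<times> penrose_sequences)"
          using q that by (auto simp: quantale_hom_def)
        then show ?thesis using hom_sup[OF q, of "{a, b}"] that by simp
      qed
      have "?d \<union> q ?m = q ?m" using sup[OF P.unit_closed m] by (simp only: em)
      moreover have "q ?m = cantor_gen (L, 0) \<union> cantor_gen (S, 0)"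
        using sup[OF gens gens, of L 0 S 0] by (simp only: g)
      ultimately show ?thesis by blast
    qed
    then have tail: "s m = t m" if "(s, t) \<in> ?d" "m > 0" for s t m
      using that by auto
    have abs: "cantor_gen (A, 0) O ?d = cantor_gen (A, 0)" for A
    proof -
      have "q (pen_bra A 0 \<otimes>\<^bsub>Pen\<^esub> qunit Pen) = q (pen_bra A 0) O ?d"
        using q gens P.unit_closed by (simp add: quantale_hom_def)
      then show ?thesis by (simp add: P.unit_right gens g)
    qed
    show "?d \<subseteq> Id_on penrose_sequences"
    proof clarify
      fix s t assume st: "(s, t) \<in> ?d"
      have dK: "?d \<subseteq> penrose_sequences \<times> penrose_sequences"
        using q P.unit_closed by (auto simp: quantale_hom_def)
      then have s: "s \<in> penrose_sequences" using st by auto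
      define A where "A = (if s 0 = 0 then L else S)"
      have s0: "s 0 = tile_val A"
      proof -
        have "s 0 \<in> {0, 1}" using s unfolding penrose_sequences_def by blast
        then show ?thesis by (auto simp: A_def tile_val_def)
      qed
      then have "(s, s) \<in> cantor_gen (A, 0)"
        using s by (simp add: cantor_gen_iff)
      then have "(s, t) \<in> cantor_gen (A, 0)" using abs[of A] st by blast
      then have "t 0 = s 0"
        using s0 by (simp add: cantor_gen_iff)
      then have "s = t" using tail[OF st] by (metis ext neq0_conv)
      then show "(s, t) \<in> Id_on penrose_sequences" using s by auto
    qed
  qed
  have ch: "quantale_hom Pen (rel_quantale penrose_sequences) cantor_rep"
    using cantor_rep(1) by (simp add: relational_rep_def)
  show ?thesis
  proof (rule hom_determined_by_gens[of pen_relations])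
    show "r (saturation pen_relations {[]}) = cantor_rep (saturation pen_relations {[]})"
      using unit_r[OF rh gen] unit_r[OF ch cantor_rep(2)] by (simp add: Pen_def)
    show "r (presented_gen pen_relations g) = cantor_rep (presented_gen pen_relations g)" for g
      using gen cantor_rep(2) by (cases g) (simp add: pen_bra_def)
  qed (use rh ch U in \<open>auto simp: Pen_def\<close>)
qed

end

theory Submission
  imports Defs
begin

text \<open>In an algebraically irreducible representation the unit acts as the identity, so by (D1) and
  (C1) every point \<open>x\<close> satisfies exactly one of \<open>x \<langle>L\<^sup>n| x\<close> and \<open>x \<langle>S\<^sup>n| x\<close> for each \<open>n\<close>, and by (C2)
  these choices form a Penrose sequence, the code of \<open>x\<close>. A generator of level \<open>n\<close> relates \<open>x\<close> to \<open>y\<close>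
  precisely when it matches the entry \<open>n\<close> of the code of \<open>y\<close> and the codes agree above \<open>n\<close>: (E2) and
  (E4) propagate the relation to all higher levels, and (D2) brings it down from a high level at
  which the connected points \<open>x\<close> and \<open>y\<close> are related. Hence codes are injective by irreducibility,
  and by (C') every sequence in the tail class of a code is a code, so the code map identifies
  the representation with a component of the Cantor representation. Conversely, joins turn
  determinism into irreducibility of the components.\<close>

section \<open>Determinism, irreducibility and equivalence over an arbitrary quantale\<close>

lemma rep_closed:
  assumes "relational_rep Q X r" "a \<in> carrier Q"
  shows "r a \<subseteq> X \<times> X"
proof -
  have "r \<in> carrier Q \<rightarrow> Pow (X \<times> X)"
    using assms(1) by (simp add: relational_rep_def quantale_hom_def)
  then show ?thesis using assms(2) by blast
qed

lemma rep_sup: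
  assumes r: "relational_rep Q X r" and A: "A \<subseteq> carrier Q"
  shows "r (\<Squnion>\<^bsub>Q\<^esub>A) = \<Union>(r ` A)"
proof -
  interpret K: quantale "rel_quantale X" by (rule quantale_rel_quantale)
  have "r ` A \<subseteq> Pow (X \<times> X)"
    using rep_closed[OF r] A by blast
  then show ?thesis
    using K.hom_sup[of Q r A] r A by (simp add: relational_rep_def)
qed

lemma algebraically_irreducibleI:
  assumes "X \<noteq> {}" and "\<And>a x. a \<in> carrier Q \<Longrightarrow> r a `` {x} \<subseteq> X"
    and "\<And>x Z. x \<in> X \<Longrightarrow> Z \<subseteq> X \<Longrightarrow> \<exists>a\<in>carrier Q. r a `` {x} = Z"
  shows "algebraically_irreducible Q X r"
proof -
  have "{r a `` {x} |a. a \<in> carrier Q} = Pow X" if "x \<in> X" for x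
  proof (intro subset_antisym subsetI)
    fix Z assume "Z \<in> Pow X"
    then obtain a where "a \<in> carrier Q" "r a `` {x} = Z" using assms(3) \<open>x \<in> X\<close> by blast
    then show "Z \<in> {r a `` {x} |a. a \<in> carrier Q}" by (intro CollectI exI[of _ a]) simp
  next
    fix Z assume "Z \<in> {r a `` {x} |a. a \<in> carrier Q}"
    then obtain a where "a \<in> carrier Q" "Z = r a `` {x}" by (elim CollectE exE conjE)
    then show "Z \<in> Pow X" using assms(2) by simp
  qed
  then show ?thesis using assms(1) by (simp add: algebraically_irreducible_def)
qed

lemma algebraically_irreducibleE:
  assumes "algebraically_irreducible Q X r" "x \<in> X" "Z \<subseteq> X"
  obtains a where "a \<in> carrier Q" "r a `` {x} = Z"
proof -
  have "Z \<in> {r a `` {x} |a. a \<in> carrier Q}"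
    using assms by (simp add: algebraically_irreducible_def)
  then show thesis using that by (elim CollectE exE conjE) simp
qed

text \<open>Determinism gives, for each point \<open>y\<close> of \<open>Z\<close>, an element
  taking \<open>x\<close> to \<open>{y}\<close>; the join of these elements takes \<open>x\<close>
  to \<open>Z\<close>.\<close>

lemma deterministic_component_irreducible:
  assumes Q: "quantale Q" and r: "relational_rep Q X r" and det: "deterministic_rep Q X r"
    and equiv: "equiv X (r \<top>\<^bsub>Q\<^esub>)" and C: "C \<in> connected_components Q X r"
  shows "algebraically_irreducible Q C (restrict_rep r C)"
proof -
  interpret quantale Q by (rule Q)
  have C': "C \<in> X // r \<top>\<^bsub>Q\<^esub>" using C by (simp add: connected_components_def)
  have CX: "C \<subseteq> X" using equiv C' by (simp add: in_quotient_imp_subset)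
  have "\<exists>a\<in>carrier Q. restrict_rep r C a `` {x} = Z" if x: "x \<in> C" and Z: "Z \<subseteq> C" for x Z
  proof -
    have "\<exists>a\<in>carrier Q. r a `` {x} = {y}" if "y \<in> Z" for y
    proof -
      have "(x, y) \<in> r \<top>\<^bsub>Q\<^esub>"
        using in_quotient_imp_in_rel[OF equiv C'] x Z that by blast
      moreover have "x \<in> X" "y \<in> X" using CX x Z that by auto
      ultimately show ?thesis
        using det by (simp add: deterministic_rep_def)
    qed
    then obtain a where a: "\<And>y. y \<in> Z \<Longrightarrow> a y \<in> carrier Q" "\<And>y. y \<in> Z \<Longrightarrow> r (a y) `` {x} = {y}"
      by metis
    have sub: "a ` Z \<subseteq> carrier Q" using a(1) by (rule image_subsetI)
    have "r (\<Squnion>\<^bsub>Q\<^esub>(a ` Z)) `` {x} = (\<Union>y\<in>Z. r (a y) `` {x})"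
      unfolding rep_sup[OF r sub] by auto
    also have "\<dots> = Z" using a(2) by simp
    finally have img: "r (\<Squnion>\<^bsub>Q\<^esub>(a ` Z)) `` {x} = Z" .
    have "restrict_rep r C b `` {x} = r b `` {x} \<inter> C" for b
      using x by (auto simp: restrict_rep_def)
    then have "restrict_rep r C (\<Squnion>\<^bsub>Q\<^esub>(a ` Z)) `` {x} = Z"
      using Z by (simp add: img Int_absorb2)
    then show ?thesis using sup_closed[OF sub] by blast
  qed
  moreover have "restrict_rep r C a `` {x} \<subseteq> C" for a x
    by (auto simp: restrict_rep_def)
  moreover have "C \<noteq> {}" using equiv C' by (rule in_quotient_imp_non_empty)
  ultimately show ?thesis by (intro algebraically_irreducibleI) simp_all
qed

lemma equivalent_reps_irreducible:
  assumes eqv: "equivalent_reps Q X r X' r'" and r: "relational_rep Q X r"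
    and irr: "algebraically_irreducible Q X' r'"
  shows "algebraically_irreducible Q X r"
proof -
  from eqv obtain f where bij: "bij_betw f (Pow X) (Pow X')"
    and Un: "\<forall>\<Z>. \<Z> \<subseteq> Pow X \<longrightarrow> f (\<Union>\<Z>) = \<Union>(f ` \<Z>)"
    and act: "\<forall>a\<in>carrier Q. \<forall>Z\<in>Pow X. f (r a `` Z) = r' a `` f Z"
    unfolding equivalent_reps_def by (elim exE conjE)
  have inj: "Y = Z" if "f Y = f Z" "Y \<subseteq> X" "Z \<subseteq> X" for Y Z
    using bij_betw_imp_inj_on[OF bij] that by (meson PowI inj_onD)
  have surj: "\<exists>Y\<subseteq>X. f Y = Z" if "Z \<subseteq> X'" for Z
    using bij_betw_imp_surj_on[OF bij] that by (metis PowD PowI imageE)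
  have maps: "f Y \<subseteq> X'" if "Y \<subseteq> X" for Y
    using bij_betwE[OF bij] that by blast
  have f0: "f {} = {}" using Un[rule_format, of "{}"] by simp
  have f2: "f (Y \<union> Z) = f Y \<union> f Z" if "Y \<subseteq> X" "Z \<subseteq> X" for Y Z
    using Un[rule_format, of "{Y, Z}"] that by simp
  obtain s0 where "s0 \<in> X'" using irr by (auto simp: algebraically_irreducible_def)
  then obtain Y0 where "Y0 \<subseteq> X" "f Y0 = {s0}" using surj[of "{s0}"] by blast
  then have "X \<noteq> {}" using f0 by auto
  moreover have "\<exists>a\<in>carrier Q. r a `` {x} = Z" if x: "x \<in> X" and Z: "Z \<subseteq> X" for x Z
  proof -
    have "f {x} \<noteq> {}" using inj[of "{x}" "{}"] f0 x by auto
    then obtain s where s: "s \<in> f {x}" by blast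
    then have sX: "s \<in> X'" using maps[of "{x}"] x by blast
    \<comment> \<open>\<open>f\<close> sends atoms to atoms: the preimage \<open>Y\<close> of
      \<open>{s}\<close> is nonempty and lies below \<open>{x}\<close>, so it is
      \<open>{x}\<close>.\<close>
    then obtain Y where Y: "Y \<subseteq> X" "f Y = {s}" using surj[of "{s}"] by blast
    have "f (Y \<union> {x}) = f {x}" using f2[of Y "{x}"] Y x s by auto
    then have "Y \<union> {x} = {x}" using inj Y x by auto
    moreover have "Y \<noteq> {}" using Y f0 by auto
    ultimately have "Y = {x}" by auto
    then have fx: "f {x} = {s}" using Y by simp
    obtain a where a: "a \<in> carrier Q" "r' a `` {s} = f Z"
      by (rule algebraically_irreducibleE[OF irr sX maps[OF Z]])
    then have "f (r a `` {x}) = f Z" using act x fx by simp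
    moreover have "r a `` {x} \<subseteq> X" using rep_closed[OF r a(1)] by blast
    ultimately have "r a `` {x} = Z" using inj Z by simp
    then show ?thesis using a(1) by (rule bexI)
  qed
  moreover have "r a `` {x} \<subseteq> X" if "a \<in> carrier Q" for a x
    using rep_closed[OF r that] by blast
  ultimately show ?thesis by (intro algebraically_irreducibleI) simp_all
qed


section \<open>Representations of presented quantales\<close>

locale presented_rep =
  fixes R :: "('g word set \<times> 'g word set) set" and X :: "'x set" and r
  assumes rep: "relational_rep (presented_quantale R) X r"
begin

definition wrel :: "'g word \<Rightarrow> ('x \<times> 'x) set" where
  "wrel w = r (saturation R {w})"

lemma wrel_closed: "wrel w \<subseteq> X \<times> X"
  unfolding wrel_def by (rule rep_closed[OF rep]) simp

text \<open>The saturation of \<open>U\<close> is the join of the saturations of its words, and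
  \<open>r\<close> preserves joins.\<close>

lemma rep_saturation: "r (saturation R U) = (\<Union>w\<in>U. wrel w)"
proof -
  let ?A = "(\<lambda>w. saturation R {w}) ` U"
  have A: "?A \<subseteq> carrier (presented_quantale R)" by auto
  have "\<Squnion>\<^bsub>presented_quantale R\<^esub>?A = saturation R U"
    using A saturation_UN[of R "\<lambda>w. {w}" U] by simp
  then show ?thesis
    using rep_sup[OF rep A] by (simp add: wrel_def)
qed

lemma rep_words: "saturated R U \<Longrightarrow> r U = (\<Union>w\<in>U. wrel w)"
  using rep_saturation[of U] by (simp add: saturation_id)

lemma wrel_append: "wrel (u @ v) = wrel u O wrel v"
proof -
  have "r (saturation R {u} \<otimes>\<^bsub>presented_quantale R\<^esub> saturation R {v}) = wrel u O wrel v"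
    using rep unfolding relational_rep_def quantale_hom_def wrel_def by simp
  then show ?thesis
    by (simp add: wrel_def saturation_mult_left saturation_mult_right)
qed

lemma wrel_star: "wrel (word_star w) = (wrel w)\<inverse>"
proof -
  have "r (word_star ` saturation R {w}) = (wrel w)\<inverse>"
    using rep unfolding relational_rep_def quantale_hom_def wrel_def by simp
  then show ?thesis
    by (simp add: wrel_def saturation_star[symmetric])
qed

text \<open>Only an inclusion, since a homomorphism need only satisfy h(e) \<ge> e.\<close>

lemma wrel_Nil: "Id_on X \<subseteq> wrel []"
  using rep unfolding relational_rep_def quantale_hom_def wrel_def by simp

lemma wrel_relation:
  assumes "(a, b) \<in> R"
  shows "(\<Union>w\<in>a. wrel w) \<subseteq> (\<Union>w\<in>b. wrel w)"
proof -
  have "a \<subseteq> saturation R b"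
    using saturatedD(1)[OF saturated_saturation assms, of _ "[]" "[]"] saturation_incl[of b R]
    by (metis append_Nil append_Nil2 subsetD subsetI)
  then have "(\<Union>w\<in>a. wrel w) \<subseteq> (\<Union>w\<in>saturation R b. wrel w)" by blast
  also have "\<dots> = (\<Union>w\<in>b. wrel w)"
    using rep_words[of "saturation R b"] rep_saturation[of b] by simp
  finally show ?thesis .
qed

text \<open>The set of all words is saturated, hence is the top element; two points are connected
  when some word joins them.\<close>

lemma rep_top: "r \<top>\<^bsub>presented_quantale R\<^esub> = (\<Union>w. wrel w)"
proof -
  interpret quantale "presented_quantale R" by (rule quantale_presented_quantale)
  have "saturated R UNIV" by (simp add: saturated_iff)
  then have "UNIV \<subseteq> \<top>\<^bsub>presented_quantale R\<^esub>" using top_higher by simp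
  then have "\<top>\<^bsub>presented_quantale R\<^esub> = UNIV" by blast
  then show ?thesis using rep_words[OF \<open>saturated R UNIV\<close>] by simp
qed

text \<open>Reflexivity comes from the empty word, symmetry from adjoint words, transitivity from
  concatenation.\<close>

lemma equiv_rep_top: "equiv X (r \<top>\<^bsub>presented_quantale R\<^esub>)"
proof (rule equivI)
  show "r \<top>\<^bsub>presented_quantale R\<^esub> \<subseteq> X \<times> X" unfolding rep_top using wrel_closed by blast
  show "refl_on X (r \<top>\<^bsub>presented_quantale R\<^esub>)"
    unfolding rep_top using wrel_Nil by (auto intro!: refl_onI)
  show "sym (r \<top>\<^bsub>presented_quantale R\<^esub>)"
    unfolding rep_top by (rule symI) (use wrel_star in blast)
  show "trans (r \<top>\<^bsub>presented_quantale R\<^esub>)"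
    unfolding rep_top by (rule transI) (use wrel_append in blast)
qed

end


section \<open>Representations of Pen\<close>

fun bras_word :: "(nat \<Rightarrow> tile) \<Rightarrow> nat \<Rightarrow> pen_gen word" where
  "bras_word A 0 = [((A 0, 0), False)]"
| "bras_word A (Suc n) = ((A (Suc n), Suc n), False) # bras_word A n"

lemma bras_eq: "bras A n = {bras_word A n}"
  by (induction n) (simp_all add: bra_def)

lemma tile_val_inj: "tile_val A = tile_val B \<longleftrightarrow> A = B"
  by (cases A; cases B) (simp_all add: tile_val_def)

definition tile_at :: "(nat \<Rightarrow> nat) \<Rightarrow> nat \<Rightarrow> tile" where
  "tile_at t n = (if t n = 0 then L else S)"

lemma tile_val_at:
  assumes "t \<in> penrose_sequences"
  shows "tile_val (tile_at t n) = t n"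
proof -
  have "t n \<in> {0, 1}" using assms unfolding penrose_sequences_def by blast
  then show ?thesis by (auto simp: tile_at_def tile_val_def)
qed

locale pen_rep = presented_rep pen_relations X r for X :: "'x set" and r
begin

definition gen :: "tile \<Rightarrow> nat \<Rightarrow> ('x \<times> 'x) set" where
  "gen A n = wrel [((A, n), False)]"

lemma gen_closed: "gen A n \<subseteq> X \<times> X"
  unfolding gen_def by (rule wrel_closed)

lemma wrel_ket: "wrel [((A, n), True)] = (gen A n)\<inverse>"
  using wrel_star[of "[((A, n), False)]"] by (simp add: gen_def word_star_def)

lemma wrel_Cons: "wrel (x # w) = wrel [x] O wrel w"
  using wrel_append[of "[x]" w] by simp

text \<open>\<open>wrel_Cons\<close> is restricted to two-letter words; unrestricted it would go on
  splitting single letters.\<close>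

lemmas gen_relation_simps =
  bra_def ket_def wrel_Cons[of _ "[y]" for y] wrel_ket gen_def[symmetric]

lemma gen_C1: "gen L n O (gen S n)\<inverse> = {}"
  using wrel_relation[OF pen_relations.C1[of n]] by (simp add: gen_relation_simps)

lemma gen_C2: "gen S n \<subseteq> gen L (Suc n)"
  using wrel_relation[OF pen_relations.C2[of n]] by (simp add: gen_relation_simps)

lemma gen_D1: "wrel [] \<subseteq> gen L n \<union> gen S n"
  using wrel_relation[OF pen_relations.D1[of n]] by (simp add: gen_relation_simps Un_commute)

lemma gen_D2: "(gen A (Suc n))\<inverse> O gen A (Suc n) \<subseteq> gen S n \<union> gen L n"
  using wrel_relation[OF pen_relations.D2[of A n]] by (simp add: gen_relation_simps Un_commute)

lemma gen_E2: "gen A (Suc n) O gen B n \<subseteq> gen A (Suc n)"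
  using wrel_relation[OF pen_relations.E2[of A n B]] by (simp add: gen_relation_simps)

lemma gen_E4: "gen A (Suc n) O (gen B n)\<inverse> \<subseteq> gen A (Suc n)"
  using wrel_relation[OF pen_relations.E4[of A n B]] by (simp add: gen_relation_simps)

lemma gen_C':
  assumes "admissible A n" "A n = L"
  shows "wrel [] \<subseteq> wrel (bras_word A n) O (wrel (bras_word A n))\<inverse>"
  using wrel_relation[OF pen_relations.C'[OF assms]]
  by (simp add: kets_star bras_eq wrel_append wrel_star)

section \<open>The code of a point\<close>

text \<open>On \<open>X\<close> the value 0 means the tile \<open>L\<close>, because exactly one
  tile has a loop at each level (\<open>gen_refl\<close>); outside \<open>X\<close> it is a dummy
  value.\<close>

definition code :: "'x \<Rightarrow> nat \<Rightarrow> nat" where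
  "code x n = (if (x, x) \<in> gen S n then 1 else 0)"

text \<open>(C1) compares arrows with a common target, so the sources \<open>x\<close> and
  \<open>z\<close> may differ.\<close>

lemma gen_disjoint:
  assumes "(x, y) \<in> gen A n" "(z, y) \<in> gen B n"
  shows "A = B"
proof -
  have "\<not> ((u, y) \<in> gen L n \<and> (v, y) \<in> gen S n)" for u v
    using gen_C1[of n] by auto
  then show ?thesis using assms by (cases A; cases B) simp_all
qed

lemma ex_gen_refl:
  assumes "x \<in> X"
  obtains A where "(x, x) \<in> gen A n"
proof -
  have "(x, x) \<in> gen L n \<union> gen S n"
    using wrel_Nil gen_D1[of n] assms by (meson Id_onI subsetD)
  then show thesis using that by (elim UnE)
qed

lemma gen_refl:
  assumes "x \<in> X"
  shows "(x, x) \<in> gen A n \<longleftrightarrow> code x n = tile_val A"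
proof -
  obtain B where B: "(x, x) \<in> gen B n" using ex_gen_refl[OF assms] .
  have "(x, x) \<in> gen C n \<longleftrightarrow> B = C" for C
    using gen_disjoint[OF B] B by metis
  then show ?thesis by (cases A; cases B) (simp_all add: code_def tile_val_def)
qed

lemma code_penrose:
  assumes x: "x \<in> X"
  shows "code x \<in> penrose_sequences"
proof -
  have "code x (Suc n) = 0" if "code x n = 1" for n
  proof -
    have "(x, x) \<in> gen L (Suc n)"
      using that gen_C2[of n] by (auto simp: code_def split: if_splits)
    then show ?thesis using gen_refl[OF x] by (simp add: tile_val_def)
  qed
  then show ?thesis by (auto simp: penrose_sequences_def code_def)
qed

lemma gen_code_val:
  assumes "(x, y) \<in> gen A n"
  shows "code y n = tile_val A"
proof -
  have y: "y \<in> X" using assms gen_closed by blast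
  then obtain B where "(y, y) \<in> gen B n" by (rule ex_gen_refl)
  then show ?thesis using gen_disjoint[OF assms, of y B] gen_refl[OF y] by simp
qed

section \<open>Agreement of tails\<close>

text \<open>A relational form of tail agreement: the loop makes \<open>A\<close> the tile of
  \<open>x\<close> at level \<open>m\<close>, and the arrow makes it the tile of \<open>y\<close> as
  well.\<close>

definition agree_from :: "nat \<Rightarrow> 'x \<Rightarrow> 'x \<Rightarrow> bool" where
  "agree_from n x y \<longleftrightarrow> (\<forall>m\<ge>n. \<exists>A. (x, x) \<in> gen A m \<and> (x, y) \<in> gen A m)"

lemma agree_code: "agree_from n x y \<Longrightarrow> m \<ge> n \<Longrightarrow> code x m = code y m"
  unfolding agree_from_def using gen_code_val by metis

text \<open>The loop at \<open>x\<close> of level \<open>n + 1\<close> absorbs the given arrow by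
  (E2), or its converse by (E4); the resulting arrow is absorbed one level higher by (E2), and so
  on.\<close>

lemma agree_step:
  assumes "(x, y) \<in> gen B n \<union> (gen B n)\<inverse>"
  shows "agree_from (Suc n) x y"
proof -
  have x: "x \<in> X" using assms gen_closed by blast
  have "\<exists>A. (x, x) \<in> gen A m \<and> (x, y) \<in> gen A m" if "m \<ge> Suc n" for m
    using that
  proof (induction m rule: dec_induct)
    case base
    obtain A where "(x, x) \<in> gen A (Suc n)" using ex_gen_refl[OF x] .
    then show ?case using assms gen_E2[of A n B] gen_E4[of A n B] by blast
  next
    case (step m)
    then obtain B where B: "(x, y) \<in> gen B m" by blast
    obtain A where "(x, x) \<in> gen A (Suc m)" using ex_gen_refl[OF x] .
    then show ?case using B gen_E2[of A m B] by blast
  qed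
  then show ?thesis by (simp add: agree_from_def)
qed

text \<open>By (E2) an arrow from \<open>x\<close> to \<open>y\<close> absorbs an arrow from
  \<open>y\<close> to \<open>z\<close> that lies one level lower; \<open>Suc\<close> leaves room for
  that lower level.\<close>

lemma agree_trans:
  assumes xy: "agree_from m x y" and yz: "agree_from n y z"
  shows "agree_from (Suc (max m n)) x z"
  unfolding agree_from_def
proof (intro allI impI)
  fix k assume "Suc (max m n) \<le> k"
  then obtain k' where k: "k = Suc k'" "m \<le> k'" "n \<le> k'" by (cases k) auto
  obtain B where "(y, z) \<in> gen B k'" using yz k unfolding agree_from_def by blast
  moreover obtain A where A: "(x, x) \<in> gen A k" "(x, y) \<in> gen A k"
    using xy k unfolding agree_from_def by (meson le_SucI)
  ultimately have "(x, z) \<in> gen A k" using gen_E2 k(1) by blast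
  then show "\<exists>A. (x, x) \<in> gen A k \<and> (x, z) \<in> gen A k" using A by blast
qed

text \<open>Each letter fixes the entry at its own level and preserves those above. Levels descend
  along the word, so later letters keep what earlier ones fixed.\<close>

lemma bras_code:
  assumes "(x, y) \<in> wrel (bras_word A n)"
  shows "(\<forall>i\<le>n. code y i = tile_val (A i)) \<and> (\<forall>m>n. code y m = code x m)"
  using assms
proof (induction n arbitrary: x)
  case 0
  then have "(x, y) \<in> gen (A 0) 0" by (simp add: gen_def)
  then show ?case using gen_code_val agree_code[OF agree_step, of x y "A 0" 0] by auto
next
  case (Suc n)
  then obtain z where z: "(x, z) \<in> gen (A (Suc n)) (Suc n)" "(z, y) \<in> wrel (bras_word A n)"
    using wrel_Cons[of _ "bras_word A n"] by (auto simp: gen_def)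
  have "code z (Suc n) = tile_val (A (Suc n))" using gen_code_val z(1) .
  moreover have "code z m = code x m" if "m > Suc n" for m
    using agree_code[OF agree_step, of x z "A (Suc n)" "Suc n" m] z(1) that by auto
  ultimately show ?case using Suc.IH[OF z(2)] by (auto simp: le_Suc_eq)
qed

end

section \<open>Strictly unital representations of \<open>Pen\<close>\<close>

text \<open>Covers both the Cantor representation and the algebraically irreducible ones.\<close>

locale strict_pen_rep = pen_rep +
  assumes strict: "wrel [] = Id_on X"
begin

text \<open>Each letter gives agreement above its level, and \<open>agree_trans\<close> chains the
  letters. Strictness settles the empty word, which joins a point only to itself.\<close>

lemma connected_agree:
  assumes "(x, y) \<in> wrel w"
  shows "\<exists>n. agree_from n x y"
  using assms
proof (induction w arbitrary: x)
  case Nil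
  then have "x \<in> X" "y = x" using strict by auto
  then have "agree_from 0 x y" unfolding agree_from_def by (metis ex_gen_refl)
  then show ?case ..
next
  case (Cons l w)
  obtain A n b where l: "l = ((A, n), b)" by (metis surj_pair)
  obtain z where z: "(x, z) \<in> wrel [l]" "(z, y) \<in> wrel w"
    using Cons.prems wrel_Cons[of l w] by blast
  have "(x, z) \<in> gen A n \<union> (gen A n)\<inverse>"
    using z(1) wrel_ket[of A n] by (cases b) (auto simp: l gen_def)
  then show ?case using agree_step agree_trans Cons.IH[OF z(2)] by blast
qed

lemma gen_iff:
  assumes "x \<in> X" and "y \<in> X" and conn: "(x, y) \<in> r \<top>\<^bsub>Pen\<^esub>"
  shows "(x, y) \<in> gen A n \<longleftrightarrow> (code x, code y) \<in> cantor_gen (A, n)"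
proof
  assume "(x, y) \<in> gen A n"
  then show "(code x, code y) \<in> cantor_gen (A, n)"
    using agree_code[OF agree_step[of x y A n]] gen_code_val[of x y A n] assms code_penrose
    by (auto simp: cantor_gen_iff)
next
  assume "(code x, code y) \<in> cantor_gen (A, n)"
  then have y: "code y n = tile_val A" and tail: "\<And>m. m > n \<Longrightarrow> code x m = code y m"
    by (auto simp: cantor_gen_iff)
  obtain N where N: "agree_from N x y"
    using conn connected_agree rep_top unfolding Pen_def by blast
  \<comment> \<open>Descent starts at level \<open>n + N\<close>, which is at least
    \<open>N\<close>, so an arrow exists there, and at least \<open>n\<close>, the level to be
    reached.\<close>
  have "\<exists>B. (x, y) \<in> gen B n"
    using le_add1[of n N]
  proof (induction rule: inc_induct)
    case base
    then show ?case using N le_add2[of N n] unfolding agree_from_def by blast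
  next
    case (step m)
    then obtain B where B: "(x, y) \<in> gen B (Suc m)" by blast
    \<comment> \<open>As \<open>Suc m\<close> exceeds \<open>n\<close>, the codes agree there, so
      \<open>x\<close> has a loop with the same tile \<open>B\<close>; (D2) applied to this loop and
      the arrow lowers the level by one.\<close>
    then have "code x (Suc m) = tile_val B" using gen_code_val tail step by simp
    then have "(x, x) \<in> gen B (Suc m)" using gen_refl assms(1) by simp
    then show ?case using B gen_D2[of B m] by blast
  qed
  then show "(x, y) \<in> gen A n" using gen_code_val y tile_val_inj by metis
qed

end


section \<open>The Cantor representation\<close>

text \<open>The universal property yields a strictly unital homomorphism, so the results on codes
  apply to \<open>cantor_rep\<close> itself.\<close>

interpretation cantor: strict_pen_rep penrose_sequences cantor_rep
proof -
  interpret pen_rep penrose_sequences cantor_rep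
    using cantor_rep(1) by (simp add: pen_rep_def presented_rep_def Pen_def)
  have "cantor_rep (saturation pen_relations {[]}) = Id_on penrose_sequences"
    using quantale.presented_quantale_exists(1)[OF quantale_rel_quantale cantor_gen_closed cantor_relations]
    by (simp add: strictly_unital_hom_def cantor_rep_def)
  then show "strict_pen_rep penrose_sequences cantor_rep"
    by unfold_locales (simp add: wrel_def)
qed

lemma cantor_gen_eq: "cantor.gen A n = cantor_gen (A, n)"
  using cantor_rep(2)[of A n] by (simp add: cantor.gen_def cantor.wrel_def pen_bra_def presented_gen_def)

lemma cantor_code:
  assumes "s \<in> penrose_sequences"
  shows "cantor.code s = s"
proof
  fix n
  have "s n \<in> {0, 1}" using assms unfolding penrose_sequences_def by blast
  then show "cantor.code s n = s n"
    unfolding cantor.code_def cantor_gen_eq cantor_gen_iff using assms by (auto simp: tile_val_def)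
qed

lemma cantor_wrel_tile:
  assumes "s \<in> penrose_sequences" "t \<in> penrose_sequences" "\<forall>m>n. s m = t m"
  shows "(s, t) \<in> cantor.wrel [((tile_at t n, n), False)]"
proof -
  have "(s, t) \<in> cantor_gen (tile_at t n, n)"
    unfolding cantor_gen_iff by (intro conjI assms) (rule tile_val_at[OF assms(2), symmetric])
  then show ?thesis by (simp only: cantor_gen_eq[symmetric] cantor.gen_def)
qed

text \<open>For the converse one letter suffices: the generator of level \<open>n\<close> with the
  tile of \<open>t\<close> puts no condition on the entries of \<open>s\<close> up to
  \<open>n\<close>.\<close>

lemma cantor_connected_iff:
  "(s, t) \<in> cantor_rep \<top>\<^bsub>Pen\<^esub> \<longleftrightarrow>
     s \<in> penrose_sequences \<and> t \<in> penrose_sequences \<and> (\<exists>n. \<forall>m>n. s m = t m)"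
proof
  assume "(s, t) \<in> cantor_rep \<top>\<^bsub>Pen\<^esub>"
  then obtain w where w: "(s, t) \<in> cantor.wrel w"
    unfolding Pen_def cantor.rep_top by blast
  then have st: "s \<in> penrose_sequences" "t \<in> penrose_sequences"
    using cantor.wrel_closed by blast+
  obtain n where "cantor.agree_from n s t" using cantor.connected_agree[OF w] ..
  then have "\<forall>m>n. s m = t m"
    using cantor.agree_code cantor_code st by (metis less_imp_le)
  then show "s \<in> penrose_sequences \<and> t \<in> penrose_sequences \<and> (\<exists>n. \<forall>m>n. s m = t m)"
    using st by blast
next
  assume "s \<in> penrose_sequences \<and> t \<in> penrose_sequences \<and> (\<exists>n. \<forall>m>n. s m = t m)"
  then obtain n where "(s, t) \<in> cantor.wrel [((tile_at t n, n), False)]"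
    using cantor_wrel_tile by blast
  then show "(s, t) \<in> cantor_rep \<top>\<^bsub>Pen\<^esub>"
    unfolding Pen_def cantor.rep_top by (rule UN_I[OF UNIV_I])
qed

text \<open>The first letter leads from \<open>s\<close> straight to \<open>t\<close>; the remaining
  letters are loops at \<open>t\<close>.\<close>

lemma cantor_bras_word:
  assumes "s \<in> penrose_sequences" "t \<in> penrose_sequences" "\<forall>m>n. s m = t m"
  shows "(s, t) \<in> cantor.wrel (bras_word (tile_at t) n)"
  using assms(1,3)
proof (induction n arbitrary: s)
  case 0
  show ?case
    unfolding bras_word.simps by (rule cantor_wrel_tile[OF 0(1) assms(2) 0(2)])
next
  case (Suc n)
  have "(t, t) \<in> cantor.wrel (bras_word (tile_at t) n)"
    by (rule Suc.IH) (simp_all add: assms(2))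
  with cantor_wrel_tile[OF Suc.prems(1) assms(2) Suc.prems(2)] show ?case
    unfolding bras_word.simps cantor.wrel_Cons[of _ "bras_word (tile_at t) n"] by (rule relcompI)
qed

text \<open>The word spelling the entries of \<open>t\<close> from \<open>n\<close> down to 0 fixes
  these entries of its target, and the tail is inherited from \<open>s\<close>, so only
  \<open>t\<close> can be reached.\<close>

lemma cantor_deterministic: "deterministic_rep Pen penrose_sequences cantor_rep"
  unfolding deterministic_rep_def
proof (intro ballI impI)
  fix s t assume st: "s \<in> penrose_sequences" "t \<in> penrose_sequences"
    and "(s, t) \<in> cantor_rep \<top>\<^bsub>Pen\<^esub>"
  then obtain n where n: "\<forall>m>n. s m = t m" by (auto simp: cantor_connected_iff)
  let ?w = "bras_word (tile_at t) n"
  have "u = t" if u: "(s, u) \<in> cantor.wrel ?w" for u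
  proof
    fix m
    have uK: "u \<in> penrose_sequences" using u cantor.wrel_closed by blast
    show "u m = t m"
      using cantor.bras_code[OF u] n uK st
      by (cases "m \<le> n") (simp_all add: cantor_code tile_val_at)
  qed
  then have "cantor.wrel ?w `` {s} = {t}"
    using cantor_bras_word[OF st n] by blast
  then show "\<exists>a\<in>carrier Pen. cantor_rep a `` {s} = {t}"
    unfolding cantor.wrel_def by (intro bexI[of _ "saturation pen_relations {?w}"]) (simp_all add: Pen_def)
qed


section \<open>Irreducible representations\<close>

locale irreducible_pen_rep = pen_rep +
  assumes irreducible: "algebraically_irreducible Pen X r"
begin

lemma transition:
  assumes "x \<in> X" "Z \<subseteq> X"
  obtains a where "saturated pen_relations a" "(\<Union>w\<in>a. wrel w) `` {x} = Z"
proof -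
  obtain a where a: "a \<in> carrier Pen" "r a `` {x} = Z"
    by (rule algebraically_irreducibleE[OF irreducible assms])
  then show thesis using that[of a] rep_words[of a] by (simp add: Pen_def)
qed

text \<open>An element taking \<open>x\<close> exactly to \<open>{x}\<close> contains a word with a
  loop at \<open>x\<close>. Appending the empty word shows that any unit arrow from \<open>x\<close>
  ends in \<open>{x}\<close>.\<close>

lemma wrel_Nil_eq: "wrel [] = Id_on X"
proof
  show "wrel [] \<subseteq> Id_on X"
  proof clarify
    fix x y assume xy: "(x, y) \<in> wrel []"
    then have x: "x \<in> X" using wrel_closed by blast
    then have "{x} \<subseteq> X" by simp
    then obtain a where a: "(\<Union>w\<in>a. wrel w) `` {x} = {x}" by (rule transition[OF x])
    then obtain w where w: "w \<in> a" "(x, x) \<in> wrel w" by blast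
    then have "(x, y) \<in> wrel w" using xy wrel_append[of w "[]"] by auto
    then have "y \<in> (\<Union>w\<in>a. wrel w) `` {x}" using w(1) by blast
    then have "y = x" by (simp add: a)
    then show "(x, y) \<in> Id_on X" using x by (simp add: Id_onI)
  qed
qed (rule wrel_Nil)

sublocale strict_pen_rep
  by unfold_locales (rule wrel_Nil_eq)

lemma connected:
  assumes "x \<in> X" "y \<in> X"
  shows "(x, y) \<in> r \<top>\<^bsub>Pen\<^esub>"
proof -
  have "{y} \<subseteq> X" using assms by simp
  then obtain a where "(\<Union>w\<in>a. wrel w) `` {x} = {y}" by (rule transition[OF assms(1)])
  then have "(x, y) \<in> (\<Union>w\<in>a. wrel w)" by blast
  then show ?thesis unfolding Pen_def rep_top by blast
qed

lemma gen_iff': "x \<in> X \<Longrightarrow> y \<in> X \<Longrightarrow> (x, y) \<in> gen A n \<longleftrightarrow> (code x, code y) \<in> cantor_gen (A, n)"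
  by (rule gen_iff[OF _ _ connected])

lemma letter_iff:
  assumes "x \<in> X" "y \<in> X"
  shows "(x, y) \<in> wrel [l] \<longleftrightarrow> (code x, code y) \<in> cantor.wrel [l]"
proof -
  obtain A n b where l: "l = ((A, n), b)" by (metis surj_pair)
  show ?thesis
    using assms gen_iff'[of x y A n] gen_iff'[of y x A n] wrel_ket[of A n] cantor.wrel_ket[of A n]
    by (cases b) (simp_all add: l gen_def[symmetric] cantor.gen_def[symmetric] cantor_gen_eq del: cantor_gen.simps)
qed

text \<open>A nonempty word cannot tell apart two points with the same code, since membership in the
  relation of its last letter depends only on codes; but some word leads from \<open>x\<close> to \<open>y\<close> and not
  to \<open>x\<close>.\<close>

lemma inj_code: "inj_on code X"
proof (rule inj_onI, rule ccontr)
  fix x y assume xy: "x \<in> X" "y \<in> X" "code x = code y" "x \<noteq> y"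
  have "{y} \<subseteq> X" using xy by simp
  then obtain a where a: "(\<Union>w\<in>a. wrel w) `` {x} = {y}" by (rule transition[OF xy(1)])
  then obtain w where w: "w \<in> a" "(x, y) \<in> wrel w" by blast
  have "w \<noteq> []" using w xy strict by auto
  then obtain u l where ul: "w = u @ [l]" by (metis rev_exhaust)
  then obtain z where z: "(x, z) \<in> wrel u" "(z, y) \<in> wrel [l]" using w(2) wrel_append[of u "[l]"] by auto
  have "z \<in> X" using z(1) wrel_closed by blast
  then have "(z, x) \<in> wrel [l]" using z(2) xy by (simp add: letter_iff)
  then have "(x, x) \<in> wrel w" using z(1) unfolding ul wrel_append by (rule relcompI[rotated])
  then have "x \<in> (\<Union>w\<in>a. wrel w) `` {x}" using w(1) by blast
  then show False using a xy(4) by simp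
qed

section \<open>Identification with a component of the Cantor representation\<close>

lemma code_agrees:
  assumes "x \<in> X" "y \<in> X"
  shows "\<exists>n. \<forall>m>n. code x m = code y m"
proof -
  obtain w where "(x, y) \<in> wrel w"
    using connected[OF assms] unfolding Pen_def rep_top by blast
  then obtain n where "agree_from n x y" using connected_agree by blast
  then have "\<forall>m>n. code x m = code y m" using agree_code less_imp_le by blast
  then show ?thesis ..
qed

text \<open>(C') gives an arrow out of \<open>x\<close> along the word spelling \<open>t\<close> up
  to level \<open>k\<close>; its end point has code \<open>t\<close>.\<close>

lemma ex_code:
  assumes x: "x \<in> X" and t: "t \<in> penrose_sequences" and agree: "\<forall>m>n. code x m = t m"
  shows "\<exists>y\<in>X. code y = t"
proof -
  \<comment> \<open>(C') requires the string to end in \<open>L\<close>; if entry \<open>n\<close>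
    of \<open>t\<close> is 1, then entry \<open>n + 1\<close> is 0.\<close>
  define k where "k = (if t n = 0 then n else Suc n)"
  have step: "t (Suc i) = 0" if "t i \<noteq> 0" for i
  proof -
    have "t i \<in> {0, 1}" "t i = 1 \<longrightarrow> t (i + 1) = 0"
      using t unfolding penrose_sequences_def by blast+
    then show ?thesis using that by auto
  qed
  then have tk: "t k = 0" "k \<ge> n" by (auto simp: k_def)
  have "admissible (tile_at t) k"
    unfolding admissible_def tile_at_def by (simp add: step)
  moreover have "tile_at t k = L" using tk by (simp add: tile_at_def)
  ultimately have "(x, x) \<in> wrel (bras_word (tile_at t) k) O (wrel (bras_word (tile_at t) k))\<inverse>"
    using gen_C' wrel_Nil x by (meson Id_onI subsetD)
  then obtain y where y: "(x, y) \<in> wrel (bras_word (tile_at t) k)" by blast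
  have "code y m = t m" for m
    using bras_code[OF y] t agree tk by (cases "m \<le> k") (simp_all add: tile_val_at)
  then show ?thesis using y wrel_closed by blast
qed

lemma code_image:
  assumes x: "x \<in> X"
  shows "code ` X = cantor_rep \<top>\<^bsub>Pen\<^esub> `` {code x}"
proof (intro subset_antisym subsetI)
  fix t assume "t \<in> code ` X"
  then obtain y where y: "y \<in> X" "t = code y" by blast
  then show "t \<in> cantor_rep \<top>\<^bsub>Pen\<^esub> `` {code x}"
    using code_agrees[OF x y(1)] code_penrose[OF x] code_penrose[OF y(1)]
    unfolding Image_singleton_iff cantor_connected_iff by simp
next
  fix t assume "t \<in> cantor_rep \<top>\<^bsub>Pen\<^esub> `` {code x}"
  then obtain n where "t \<in> penrose_sequences" "\<forall>m>n. code x m = t m"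
    unfolding Image_singleton_iff cantor_connected_iff by (elim conjE exE)
  then obtain y where "y \<in> X" "code y = t" using ex_code[OF x] by blast
  then show "t \<in> code ` X" by blast
qed

text \<open>Injectivity of \<open>code\<close> settles the empty word. For longer words, an
  intermediate sequence lies in the component of \<open>code x\<close>, so by
  \<open>code_image\<close> it lifts to a point of \<open>X\<close>.\<close>

lemma word_iff:
  assumes "x \<in> X" "y \<in> X"
  shows "(x, y) \<in> wrel w \<longleftrightarrow> (code x, code y) \<in> cantor.wrel w"
  using assms(1)
proof (induction w arbitrary: x)
  case Nil
  then show ?case
    using inj_on_eq_iff[OF inj_code Nil assms(2)] code_penrose[OF Nil]
    by (simp add: strict cantor.strict Id_on_iff)
next
  case (Cons l w)
  have "(\<exists>z. (x, z) \<in> wrel [l] \<and> (z, y) \<in> wrel w) \<longleftrightarrow>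
      (\<exists>t. (code x, t) \<in> cantor.wrel [l] \<and> (t, code y) \<in> cantor.wrel w)"
  proof
    assume "\<exists>z. (x, z) \<in> wrel [l] \<and> (z, y) \<in> wrel w"
    then obtain z where z: "(x, z) \<in> wrel [l]" "(z, y) \<in> wrel w" by blast
    then have "z \<in> X" using wrel_closed by blast
    then have "(code x, code z) \<in> cantor.wrel [l]" "(code z, code y) \<in> cantor.wrel w"
      using z letter_iff[OF Cons.prems] Cons.IH by simp_all
    then show "\<exists>t. (code x, t) \<in> cantor.wrel [l] \<and> (t, code y) \<in> cantor.wrel w" by blast
  next
    assume "\<exists>t. (code x, t) \<in> cantor.wrel [l] \<and> (t, code y) \<in> cantor.wrel w"
    then obtain t where t: "(code x, t) \<in> cantor.wrel [l]" "(t, code y) \<in> cantor.wrel w" by blast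
    have "t \<in> code ` X"
      unfolding code_image[OF Cons.prems] Pen_def cantor.rep_top using t(1) by blast
    then obtain z where z: "z \<in> X" "t = code z" by blast
    then have "(x, z) \<in> wrel [l]" "(z, y) \<in> wrel w"
      using t letter_iff[OF Cons.prems] Cons.IH by simp_all
    then show "\<exists>z. (x, z) \<in> wrel [l] \<and> (z, y) \<in> wrel w" by blast
  qed
  then show ?case
    unfolding wrel_Cons[of l w] cantor.wrel_Cons[of l w] by blast
qed

text \<open>The equivalence is the direct image under \<open>code\<close>. It commutes with the
  action because every element of \<open>Pen\<close> acts as the union of its words, to which
  \<open>word_iff\<close> applies.\<close>

lemma equivalent_component:
  "\<exists>C\<in>connected_components Pen penrose_sequences cantor_rep.
     equivalent_reps Pen X r C (restrict_rep cantor_rep C)"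
proof
  obtain x where x: "x \<in> X" using irreducible by (auto simp: algebraically_irreducible_def)
  show "code ` X \<in> connected_components Pen penrose_sequences cantor_rep"
    unfolding code_image[OF x] connected_components_def using code_penrose[OF x] by (rule quotientI)
  have act: "code ` (r a `` Z) = restrict_rep cantor_rep (code ` X) a `` (code ` Z)"
    if a: "a \<in> carrier Pen" and Z: "Z \<subseteq> X" for a Z
  proof -
    have sat: "saturated pen_relations a" using a by (simp add: Pen_def)
    have iff: "(x, y) \<in> r a \<longleftrightarrow> (code x, code y) \<in> cantor_rep a" if "x \<in> X" "y \<in> X" for x y
      using word_iff[OF that] by (simp add: rep_words[OF sat] cantor.rep_words[OF sat])
    have closed: "r a \<subseteq> X \<times> X" unfolding rep_words[OF sat] using wrel_closed by blast
    show ?thesis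
    proof (intro subset_antisym subsetI)
      fix t assume "t \<in> code ` (r a `` Z)"
      then obtain z y where zy: "z \<in> Z" "(z, y) \<in> r a" "t = code y" by blast
      then have "z \<in> X" "y \<in> X" using closed by blast+
      then have "(code z, t) \<in> restrict_rep cantor_rep (code ` X) a"
        using zy iff by (simp add: restrict_rep_def)
      then show "t \<in> restrict_rep cantor_rep (code ` X) a `` (code ` Z)"
        using zy(1) by blast
    next
      fix t assume "t \<in> restrict_rep cantor_rep (code ` X) a `` (code ` Z)"
      then obtain z where z: "z \<in> Z" "(code z, t) \<in> cantor_rep a" "t \<in> code ` X"
        unfolding restrict_rep_def by auto
      then obtain y where y: "y \<in> X" "t = code y" by blast
      have "(z, y) \<in> r a" using iff[of z y] z y Z by auto
      then show "t \<in> code ` (r a `` Z)" using z(1) y(2) by auto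
    qed
  qed
  have "bij_betw ((`) code) (Pow X) (Pow (code ` X))"
    using inj_code by (intro bij_betw_Pow) (simp add: bij_betw_def)
  moreover have "Y \<inter> Z = {} \<longleftrightarrow> code ` Y \<inter> code ` Z = {}" if "Y \<subseteq> X" "Z \<subseteq> X" for Y Z
    using inj_on_image_Int[OF inj_code that] by (metis image_is_empty)
  ultimately show "equivalent_reps Pen X r (code ` X) (restrict_rep cantor_rep (code ` X))"
    unfolding equivalent_reps_def
    by (intro exI[of _ "(`) code"] conjI allI ballI impI) (simp_all add: act image_Union)
qed

end

theorem corollary6p7:
  shows "deterministic_rep Pen penrose_sequences cantor_rep \<and>
    (\<forall>(X :: 'x set) r. relational_rep Pen X r \<longrightarrow>
       (algebraically_irreducible Pen X r \<longleftrightarrow>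
        (\<exists>C \<in> connected_components Pen penrose_sequences cantor_rep.
           equivalent_reps Pen X r C (restrict_rep cantor_rep C))))"
proof (rule conjI[OF cantor_deterministic], intro allI impI)
  fix X :: "'x set" and r assume r: "relational_rep Pen X r"
  show "algebraically_irreducible Pen X r \<longleftrightarrow>
        (\<exists>C \<in> connected_components Pen penrose_sequences cantor_rep.
           equivalent_reps Pen X r C (restrict_rep cantor_rep C))"
  proof
    assume "algebraically_irreducible Pen X r"
    then interpret irreducible_pen_rep X r
      using r by unfold_locales (simp_all add: Pen_def)
    show "\<exists>C \<in> connected_components Pen penrose_sequences cantor_rep.
           equivalent_reps Pen X r C (restrict_rep cantor_rep C)"
      by (rule equivalent_component)
  next
    \<comment> \<open>Components of the deterministic Cantor representation are irreducible, and
      irreducibility passes back along the equivalence.\<close>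
    have Q: "quantale Pen" unfolding Pen_def by (rule quantale_presented_quantale)
    have equiv: "equiv penrose_sequences (cantor_rep \<top>\<^bsub>Pen\<^esub>)"
      unfolding Pen_def by (rule cantor.equiv_rep_top)
    assume "\<exists>C \<in> connected_components Pen penrose_sequences cantor_rep.
           equivalent_reps Pen X r C (restrict_rep cantor_rep C)"
    then obtain C where C: "C \<in> connected_components Pen penrose_sequences cantor_rep"
      and eqv: "equivalent_reps Pen X r C (restrict_rep cantor_rep C)" ..
    show "algebraically_irreducible Pen X r"
      by (rule equivalent_reps_irreducible[OF eqv r
            deterministic_component_irreducible[OF Q cantor_rep(1) cantor_deterministic equiv C]])
  qed
qed

end
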